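(* Let $G$ be a finite simple biconnected chordal outerplanar graph with maximum degree $\Delta \in \{5,6\}$. If the weak dual $T^*(G)$ is not full, then either $G^2$ is a complete graph or $G$ has an $h$-separator for some $h \in \{4,5,6,7\}$.
   Context: $G^2$ is the graph on $V(G)$ in which two distinct vertices are adjacent iff their distance in $G$ is 1 or 2. For $G$ embedded in the plane with all vertices on the outer face, the weak dual $T^*(G)$ is the tree whose vertices are the bounded faces of $G$, two faces adjacent iff they share an edge. A tree is full if it has no vertex of degree 2. An $h$-separator of $G$ is a subgraph $H \subseteq G$ on $h$ vertices whose vertex set induces a clique in $G^2$ and whose removal disconnects $G^2$. *)

theory Defs
  imports "HOL-Analysis.Analysis" "HOL-Library.Ramsey" "HOL-Library.Extended_Nat"
begin

text \<open>A graph is given by its vertex set \<^term>\<open>V\<close> and its set \<^term>\<open>E\<close> of two-element edges.\<close>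

definition simple_graph :: "'a set \<Rightarrow> 'a set set \<Rightarrow> bool" where
  "simple_graph V E \<longleftrightarrow> (\<forall>e\<in>E. e \<subseteq> V \<and> card e = 2)"

definition subgraph :: "'a set \<Rightarrow> 'a set set \<Rightarrow> 'a set \<Rightarrow> 'a set set \<Rightarrow> bool" where
  "subgraph W F V E \<longleftrightarrow> simple_graph W F \<and> W \<subseteq> V \<and> F \<subseteq> E"

definition vdegree :: "'a set set \<Rightarrow> 'a \<Rightarrow> nat" where
  "vdegree E v = card {e \<in> E. v \<in> e}"

definition max_degree :: "'a set \<Rightarrow> 'a set set \<Rightarrow> nat" where
  "max_degree V E = Max (vdegree E ` V)"

definition walk :: "'a set \<Rightarrow> 'a set set \<Rightarrow> 'a list \<Rightarrow> bool" where
  "walk V E xs \<longleftrightarrow> xs \<noteq> [] \<and> set xs \<subseteq> V \<and> successively (\<lambda>u v. {u, v} \<in> E) xs"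

definition graph_dist :: "'a set \<Rightarrow> 'a set set \<Rightarrow> 'a \<Rightarrow> 'a \<Rightarrow> enat" where
  "graph_dist V E u v =
     Inf {enat (length xs - 1) | xs. walk V E xs \<and> hd xs = u \<and> last xs = v}"

definition square_edges :: "'a set \<Rightarrow> 'a set set \<Rightarrow> 'a set set" where
  "square_edges V E =
     {{u, v} | u v. u \<in> V \<and> v \<in> V \<and> u \<noteq> v \<and> graph_dist V E u v \<in> {1, 2}}"

text \<open>The empty graph counts as connected here, so that deleting all vertices
  does not disconnect a graph.\<close>

definition graph_connected :: "'a set \<Rightarrow> 'a set set \<Rightarrow> bool" where
  "graph_connected V E \<longleftrightarrow>
     (\<forall>u\<in>V. \<forall>v\<in>V. \<exists>xs. walk V E xs \<and> hd xs = u \<and> last xs = v)"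

definition edges_avoiding :: "'a set set \<Rightarrow> 'a set \<Rightarrow> 'a set set" where
  "edges_avoiding E X = {e \<in> E. e \<inter> X = {}}"

definition removal_disconnects :: "'a set \<Rightarrow> 'a set set \<Rightarrow> 'a set \<Rightarrow> bool" where
  "removal_disconnects V E X \<longleftrightarrow> \<not> graph_connected (V - X) (edges_avoiding E X)"

definition biconnected :: "'a set \<Rightarrow> 'a set set \<Rightarrow> bool" where
  "biconnected V E \<longleftrightarrow>
     V \<noteq> {} \<and> graph_connected V E \<and> (\<forall>v\<in>V. \<not> removal_disconnects V E {v})"

definition cycle_edges :: "'a list \<Rightarrow> 'a set set" where
  "cycle_edges xs = {{xs ! i, xs ! (Suc i mod length xs)} | i. i < length xs}"

definition is_cycle :: "'a set set \<Rightarrow> 'a list \<Rightarrow> bool" where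
  "is_cycle E xs \<longleftrightarrow> 3 \<le> length xs \<and> distinct xs \<and> cycle_edges xs \<subseteq> E"

definition chordal :: "'a set set \<Rightarrow> bool" where
  "chordal E \<longleftrightarrow>
     (\<forall>xs. is_cycle E xs \<and> 4 \<le> length xs \<longrightarrow> (\<exists>e\<in>E. e \<subseteq> set xs \<and> e \<notin> cycle_edges xs))"

definition plane_embedding ::
  "'a set \<Rightarrow> 'a set set \<Rightarrow> ('a \<Rightarrow> complex) \<Rightarrow> ('a set \<Rightarrow> real \<Rightarrow> complex) \<Rightarrow> bool" where
  "plane_embedding V E \<phi> \<gamma> \<longleftrightarrow>
     inj_on \<phi> V \<and>
     (\<forall>e\<in>E. arc (\<gamma> e) \<and> {pathstart (\<gamma> e), pathfinish (\<gamma> e)} = \<phi> ` e) \<and>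
     (\<forall>e\<in>E. path_image (\<gamma> e) \<inter> \<phi> ` V = \<phi> ` e) \<and>
     (\<forall>e\<in>E. \<forall>e'\<in>E. e \<noteq> e' \<longrightarrow> path_image (\<gamma> e) \<inter> path_image (\<gamma> e') = \<phi> ` (e \<inter> e'))"

definition drawing ::
  "'a set \<Rightarrow> 'a set set \<Rightarrow> ('a \<Rightarrow> complex) \<Rightarrow> ('a set \<Rightarrow> real \<Rightarrow> complex) \<Rightarrow> complex set" where
  "drawing V E \<phi> \<gamma> = \<phi> ` V \<union> (\<Union>e\<in>E. path_image (\<gamma> e))"

definition faces ::
  "'a set \<Rightarrow> 'a set set \<Rightarrow> ('a \<Rightarrow> complex) \<Rightarrow> ('a set \<Rightarrow> real \<Rightarrow> complex) \<Rightarrow> complex set set" where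
  "faces V E \<phi> \<gamma> = components (- drawing V E \<phi> \<gamma>)"

definition outerplane_embedding ::
  "'a set \<Rightarrow> 'a set set \<Rightarrow> ('a \<Rightarrow> complex) \<Rightarrow> ('a set \<Rightarrow> real \<Rightarrow> complex) \<Rightarrow> bool" where
  "outerplane_embedding V E \<phi> \<gamma> \<longleftrightarrow>
     plane_embedding V E \<phi> \<gamma> \<and>
     (\<exists>F\<in>faces V E \<phi> \<gamma>. \<not> bounded F \<and> \<phi> ` V \<subseteq> frontier F)"

definition weak_dual_verts ::
  "'a set \<Rightarrow> 'a set set \<Rightarrow> ('a \<Rightarrow> complex) \<Rightarrow> ('a set \<Rightarrow> real \<Rightarrow> complex) \<Rightarrow> complex set set" where
  "weak_dual_verts V E \<phi> \<gamma> = {F \<in> faces V E \<phi> \<gamma>. bounded F}"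

definition weak_dual_edges ::
  "'a set \<Rightarrow> 'a set set \<Rightarrow> ('a \<Rightarrow> complex) \<Rightarrow> ('a set \<Rightarrow> real \<Rightarrow> complex) \<Rightarrow> complex set set set" where
  "weak_dual_edges V E \<phi> \<gamma> =
     {{F, F'} | F F'. F \<in> weak_dual_verts V E \<phi> \<gamma> \<and> F' \<in> weak_dual_verts V E \<phi> \<gamma> \<and> F \<noteq> F' \<and>
        (\<exists>e\<in>E. path_image (\<gamma> e) \<subseteq> frontier F \<and> path_image (\<gamma> e) \<subseteq> frontier F')}"

definition full :: "'a set \<Rightarrow> 'a set set \<Rightarrow> bool" where
  "full V E \<longleftrightarrow> (\<forall>v\<in>V. vdegree E v \<noteq> 2)"

definition separator ::
  "'a set \<Rightarrow> 'a set set \<Rightarrow> nat \<Rightarrow> 'a set \<Rightarrow> 'a set set \<Rightarrow> bool" where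
  "separator V E h W F \<longleftrightarrow>
     subgraph W F V E \<and> card W = h \<and>
     clique W (square_edges V E) \<and> removal_disconnects V (square_edges V E) W"

end

theory Submission
  imports Defs
begin

text \<open>
  Every triangle of \<open>G\<close> bounds a face, because no vertex lies inside a cycle of an outerplane drawing.
  Conversely every bounded face is of this form: eliminating simplicial vertices of the chordal graph
  one at a time, Janiszewski's theorem shows that the drawing together with the insides of all its
  triangles does not separate the plane; \<open>K\<^sub>4\<close> is excluded by the same argument, and a theta
  curve excludes three triangles on one edge. Hence a face of degree 2 in the weak dual is a triangle \<open>xyz\<close>
  with further triangles on \<open>xy\<close> and \<open>xz\<close> and none on \<open>yz\<close>. By chordality there is no path from \<open>y\<close>
  to \<open>z\<close> avoiding \<open>x\<close> and the edge \<open>yz\<close>, so the other vertices split into a part \<open>A\<close> on the side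
  of \<open>y\<close> and a part \<open>B\<close> on the side of \<open>z\<close>, joined in the square only through neighbours of \<open>x\<close>. The closed
  neighbourhood of \<open>x\<close>, a clique of the square, therefore separates if \<open>x\<close> dominates neither part;
  if \<open>x\<close> dominates exactly one part, it still separates after leaving out one vertex of that
  part; and if \<open>x\<close> dominates both, the square is complete.
\<close>

section \<open>Chordal graphs and squares\<close>

lemma simple_graph_edgeD:
  assumes "simple_graph V E" "{a, b} \<in> E"
  shows "a \<in> V" "b \<in> V" "a \<noteq> b"
  using assms by (auto simp: simple_graph_def)

text \<open>Replaces the infimum in \<open>graph_dist\<close> by explicit edges: a nonempty set of
  \<open>enat\<close> values attains its infimum, so distance 1 or 2 is witnessed by a walk with two
  or three vertices.\<close>

lemma square_edges_iff:
  assumes sg: "simple_graph V E"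
  shows "{u, v} \<in> square_edges V E \<longleftrightarrow>
    u \<in> V \<and> v \<in> V \<and> u \<noteq> v \<and> ({u, v} \<in> E \<or> (\<exists>w. {u, w} \<in> E \<and> {w, v} \<in> E))"
proof -
  have dist: "graph_dist V E u v \<in> {1, 2} \<longleftrightarrow> {u, v} \<in> E \<or> (\<exists>w. {u, w} \<in> E \<and> {w, v} \<in> E)"
    if uv: "u \<in> V" "v \<in> V" "u \<noteq> v" for u v
  proof -
    let ?S = "{enat (length xs - 1) | xs. walk V E xs \<and> hd xs = u \<and> last xs = v}"
    \<comment> \<open>The truncated \<open>length xs - 1\<close> is 0 for the empty list too, but
      \<open>walk\<close> excludes that list.\<close>
    have "0 \<notin> ?S"
    proof
      assume "0 \<in> ?S"
      then obtain xs where "walk V E xs" "hd xs = u" "last xs = v" "length xs \<le> 1"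
        by (auto simp: zero_enat_def)
      then show False
        using uv by (cases xs) (auto simp: walk_def)
    qed
    have mem: "Inf ?S \<in> ?S" if "?S \<noteq> {}"
      using that by (meson ex_in_conv wellorder_InfI)
    have ne0: "Inf ?S \<noteq> 0"
    proof (cases "?S = {}")
      case True
      then show ?thesis
        by (metis (no_types, lifting) Inf_enat_def i0_ne_infinity)
    qed (use mem \<open>0 \<notin> ?S\<close> in metis)
    show ?thesis
    proof
      assume d: "graph_dist V E u v \<in> {1, 2}"
      then have "?S \<noteq> {}"
        unfolding graph_dist_def
        by (smt (verit, best) Inf_enat_def infinity_ne_i1 empty_iff insert_iff numeral_ne_infinity)
      with mem d have "\<exists>xs. walk V E xs \<and> hd xs = u \<and> last xs = v \<and> enat (length xs - 1) \<in> {1, 2}"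
        unfolding graph_dist_def by (smt (verit) mem_Collect_eq)
      then obtain xs where xs: "walk V E xs" "hd xs = u" "last xs = v" "length xs = 2 \<or> length xs = 3"
        by (fastforce simp: one_enat_def numeral_eq_enat)
      then show "{u, v} \<in> E \<or> (\<exists>w. {u, w} \<in> E \<and> {w, v} \<in> E)"
        by (auto simp: walk_def length_Suc_conv numeral_2_eq_2 numeral_3_eq_3)
    next
      assume "{u, v} \<in> E \<or> (\<exists>w. {u, w} \<in> E \<and> {w, v} \<in> E)"
      then consider "{u, v} \<in> E" | w where "{u, w} \<in> E" "{w, v} \<in> E"
        by blast
      then have "\<exists>xs. walk V E xs \<and> hd xs = u \<and> last xs = v \<and> length xs - 1 \<le> 2"
      proof cases
        case 1
        then show ?thesis
          by (intro exI[of _ "[u, v]"]) (auto simp: walk_def uv)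
      next
        case 2
        then show ?thesis
          using simple_graph_edgeD[OF sg]
          by (intro exI[of _ "[u, w, v]"]) (auto simp: walk_def uv)
      qed
      then obtain xs where "walk V E xs" "hd xs = u" "last xs = v" "length xs - 1 \<le> 2"
        by blast
      then have "Inf ?S \<le> enat (length xs - 1)"
        by (intro Inf_lower) blast
      also have "\<dots> \<le> 2"
        using \<open>length xs - 1 \<le> 2\<close> by (simp add: numeral_eq_enat)
      finally have "Inf ?S \<le> 2" .
      then obtain n where "Inf ?S = enat n" "n \<le> 2"
        by (cases "Inf ?S") (auto simp: numeral_eq_enat)
      moreover have "n \<noteq> 0"
        using ne0 calculation by (auto simp: zero_enat_def)
      ultimately have "Inf ?S = 1 \<or> Inf ?S = 2"
        by (auto simp: one_enat_def numeral_eq_enat)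
      then show "graph_dist V E u v \<in> {1, 2}"
        unfolding graph_dist_def by blast
    qed
  qed
  show ?thesis (is "?L \<longleftrightarrow> ?R")
  proof
    assume ?L
    then obtain a b where ab: "{u, v} = {a, b}" "a \<in> V" "b \<in> V" "a \<noteq> b" "graph_dist V E a b \<in> {1, 2}"
      unfolding square_edges_def by blast
    then have "{a, b} \<in> E \<or> (\<exists>w. {a, w} \<in> E \<and> {w, b} \<in> E)"
      using dist by blast
    with ab show ?R
      by (auto simp: doubleton_eq_iff insert_commute)
  next
    assume ?R
    then show ?L
      unfolding square_edges_def using dist by blast
  qed
qed

section \<open>Detours around an edge of a chordal graph\<close>

text \<open>As \<open>y\<close> shifts the indices by one, position \<open>i\<close> of the whole
  list is the last vertex before the gap and position \<open>Suc j\<close> the first one after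
  it.\<close>

lemma successively_shortcut:
  assumes "successively P (y # p @ [z])" "i \<le> j" "j \<le> length p"
    and "P ((y # p @ [z]) ! i) ((y # p @ [z]) ! Suc j)"
  shows "successively P (y # (take i p @ drop j p) @ [z])"
proof -
  let ?xs = "y # p @ [z]"
  have eq: "y # (take i p @ drop j p) @ [z] = take (Suc i) ?xs @ drop (Suc j) ?xs"
    using assms by simp
  have "successively P (take (Suc i) ?xs)" "successively P (drop (Suc j) ?xs)"
    using assms(1) by (metis append_take_drop_id successively_append_iff)+
  moreover have "last (take (Suc i) ?xs) = ?xs ! i"
  proof -
    have "i < length ?xs"
      using assms by simp
    then show ?thesis
      by (simp only: take_Suc_conv_app_nth last_snoc)
  qed
  moreover have "hd (drop (Suc j) ?xs) = ?xs ! Suc j"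
    using assms by (intro hd_drop_conv_nth) auto
  ultimately show ?thesis
    unfolding eq using assms(4) by (simp only: successively_append_iff) simp
qed

text \<open>A repeated inner vertex, or a chord of the cycle closed by \<open>{y, z}\<close>, gives
  a shorter detour with inner vertices still in \<open>R\<close>. Chordality supplies a chord until
  a single inner vertex is left.\<close>

lemma chordal_edge_detour:
  assumes sg: "simple_graph V E" and ch: "chordal E" and yz: "{y, z} \<in> E"
    and R: "y \<notin> R" "z \<notin> R"
    and "p \<noteq> []" "set p \<subseteq> R" "successively (\<lambda>u v. {u, v} \<in> E) (y # p @ [z])"
  shows "\<exists>c\<in>R. {y, c} \<in> E \<and> {c, z} \<in> E"
  using assms(6-8)
proof (induction "length p" arbitrary: p rule: less_induct)
  case less
  let ?xs = "y # p @ [z]"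
  have "y \<noteq> z"
    using simple_graph_edgeD[OF sg yz] by blast
  \<comment> \<open>The last condition rules out the shortcut from \<open>y\<close> straight to
    \<open>z\<close>, which would leave no inner vertex.\<close>
  have short: ?case if "{?xs ! i, ?xs ! Suc j} \<in> E" "i < j" "j \<le> length p" "0 < i \<or> j < length p" for i j
  proof (rule less.hyps)
    show "length (take i p @ drop j p) < length p" "take i p @ drop j p \<noteq> []"
      using that by auto
    show "set (take i p @ drop j p) \<subseteq> R"
      using less.prems(2) by (auto dest: in_set_takeD in_set_dropD)
    show "successively (\<lambda>u v. {u, v} \<in> E) (y # (take i p @ drop j p) @ [z])"
      using that less.prems by (intro successively_shortcut) auto
  qed
  consider "length p = 1" | "\<not> distinct p" | "distinct p" "2 \<le> length p"
    using less.prems(1) by (cases p) (auto simp: Suc_le_eq)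
  then show ?case
  proof cases
    case 1
    then show ?thesis
      using less.prems by (auto simp: length_Suc_conv)
  next
    case 2
    then obtain a b where ab: "a < b" "b < length p" "p ! a = p ! b"
      by (metis distinct_conv_nth linorder_neqE_nat)
    \<comment> \<open>The edge into the first occurrence of the repeated vertex also leads to its
      second occurrence and so serves as the shortcut.\<close>
    have "{?xs ! a, ?xs ! Suc a} \<in> E"
      using less.prems(3) ab unfolding successively_conv_nth by (auto simp del: nth_Cons_Suc)
    moreover have "?xs ! Suc a = ?xs ! Suc b"
      using ab by (simp add: nth_append)
    ultimately show ?thesis
      using short[of a b] ab by simp
  next
    case 3
    have dist: "distinct ?xs"
      using 3 less.prems R \<open>y \<noteq> z\<close> by auto
    have "is_cycle E ?xs"
      unfolding is_cycle_def
    proof (intro conjI)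
      show "cycle_edges ?xs \<subseteq> E"
      proof
        fix e assume "e \<in> cycle_edges ?xs"
        then obtain i where i: "e = {?xs ! i, ?xs ! (Suc i mod length ?xs)}" "i < length ?xs"
          unfolding cycle_edges_def by blast
        show "e \<in> E"
        proof (cases "Suc i < length ?xs")
          case True
          then show ?thesis
            using i less.prems(3) unfolding successively_conv_nth by (auto simp del: nth_Cons_Suc)
        next
          case False
          then have "i = Suc (length p)"
            using i by simp
          then have "e = {z, y}"
            using i by (simp add: nth_append)
          then show ?thesis
            using yz by (simp add: insert_commute)
        qed
      qed
    qed (use 3 dist in auto)
    then obtain e where e: "e \<in> E" "e \<subseteq> set ?xs" "e \<notin> cycle_edges ?xs"
      using ch 3 unfolding chordal_def by fastforce
    then obtain u v where uv: "e = {u, v}" "u \<noteq> v"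
      using sg unfolding simple_graph_def by (metis card_2_iff)
    have "\<exists>i j. i < j \<and> j < length ?xs \<and> e = {?xs ! i, ?xs ! j}"
    proof -
      obtain i j where "i < length ?xs" "j < length ?xs" "?xs ! i = u" "?xs ! j = v"
        using e(2) uv by (metis in_set_conv_nth insert_subset)
      then show ?thesis
        using uv by (metis insert_commute linorder_neqE_nat)
    qed
    then obtain i j where ij: "i < j" "j < length ?xs" "e = {?xs ! i, ?xs ! j}"
      by blast
    \<comment> \<open>The chord is neither a path edge nor the closing edge, which is what
      \<open>short\<close> asks of it.\<close>
    have "j \<noteq> Suc i"
    proof
      assume "j = Suc i"
      then have "e = {?xs ! i, ?xs ! (Suc i mod length ?xs)}" "i < length ?xs"
        using ij by auto
      then show False
        using e(3) unfolding cycle_edges_def by blast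
    qed
    moreover have "\<not> (i = 0 \<and> j = Suc (length p))"
    proof
      assume "i = 0 \<and> j = Suc (length p)"
      then have "e = {?xs ! j, ?xs ! (Suc j mod length ?xs)}"
        using ij by (simp add: insert_commute)
      then show False
        using e(3) ij(2) unfolding cycle_edges_def by blast
    qed
    moreover obtain k where k: "j = Suc k"
      using ij(1) by (cases j) auto
    ultimately show ?thesis
      using short[of i k] ij e(1) by simp linarith
  qed
qed

text \<open>Kept as a relation so that its reflexive transitive closure expresses reachability
  inside the subgraph induced by \<open>R\<close>.\<close>

definition adj_within :: "'a set set \<Rightarrow> 'a set \<Rightarrow> ('a \<times> 'a) set" where
  "adj_within E R = {(u, v). u \<in> R \<and> v \<in> R \<and> {u, v} \<in> E}"

lemma sym_adj_within: "sym (adj_within E R)"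
  by (auto simp: sym_def adj_within_def insert_commute)

lemma adj_within_path:
  assumes "(a, b) \<in> (adj_within E R)\<^sup>*" "a \<in> R"
  shows "\<exists>p. p \<noteq> [] \<and> hd p = a \<and> last p = b \<and> set p \<subseteq> R \<and> successively (\<lambda>u v. {u, v} \<in> E) p"
  using assms
proof (induction rule: rtrancl_induct)
  case base
  then show ?case
    by (intro exI[of _ "[a]"]) auto
next
  case (step b c)
  then obtain p where "p \<noteq> []" "hd p = a" "last p = b" "set p \<subseteq> R" "successively (\<lambda>u v. {u, v} \<in> E) p"
    by blast
  then show ?case
    using step.hyps by (intro exI[of _ "p @ [c]"]) (auto simp: adj_within_def successively_append_iff)
qed

lemma chordal_edge_detour_rtrancl:
  assumes "simple_graph V E" "chordal E" "{y, z} \<in> E" "y \<notin> R" "z \<notin> R"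
    and "{y, n} \<in> E" "n \<in> R" "(n, a) \<in> (adj_within E R)\<^sup>*" "{a, z} \<in> E"
  shows "\<exists>c\<in>R. {y, c} \<in> E \<and> {c, z} \<in> E"
proof -
  obtain p where "p \<noteq> []" "hd p = n" "last p = a" "set p \<subseteq> R" "successively (\<lambda>u v. {u, v} \<in> E) p"
    using adj_within_path[OF assms(8,7)] by blast
  then show ?thesis
    using assms
    by (intro chordal_edge_detour[of V E y z R p])
      (auto simp: successively_Cons successively_append_iff)
qed

section \<open>Simplicial vertices of chordal graphs\<close>

definition simplicial_in :: "'a set set \<Rightarrow> 'a set \<Rightarrow> 'a \<Rightarrow> bool" where
  "simplicial_in E U v \<longleftrightarrow> v \<in> U \<and>
     (\<forall>a\<in>U. \<forall>b\<in>U. {v, a} \<in> E \<and> {v, b} \<in> E \<and> a \<noteq> b \<longrightarrow> {a, b} \<in> E)"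

text \<open>Dirac's argument, strengthened for the induction by keeping the simplicial vertex away
  from \<open>v\<close>. Let \<open>C\<close> be the component of \<open>w\<close> among the
  non-neighbours of \<open>v\<close>, and \<open>S\<close> the neighbours of \<open>v\<close>
  attached to \<open>C\<close>. The smaller set \<open>C \<union> S\<close> has a simplicial vertex
  in \<open>C\<close>, and vertices of \<open>C\<close> have no neighbours in \<open>U\<close>
  outside \<open>C \<union> S\<close>.\<close>

lemma chordal_simplicial_nonneighbour:
  assumes sg: "simple_graph V E" and ch: "chordal E" and "finite U"
    and "v \<in> U" "w \<in> U" "w \<noteq> v" "{v, w} \<notin> E"
  shows "\<exists>u. simplicial_in E U u \<and> u \<noteq> v \<and> {v, u} \<notin> E"
  using assms(3-)
proof (induction "card U" arbitrary: U v w rule: less_induct)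
  case less
  define R where "R = {u \<in> U. u \<noteq> v \<and> {v, u} \<notin> E}"
  define C where "C = {u. (w, u) \<in> (adj_within E R)\<^sup>*}"
  define S where "S = {s \<in> U. {v, s} \<in> E \<and> (\<exists>c\<in>C. {s, c} \<in> E)}"
  have "w \<in> R" "w \<in> C"
    using less.prems by (auto simp: R_def C_def)
  have CR: "C \<subseteq> R"
  proof
    fix u assume "u \<in> C"
    then have "(w, u) \<in> (adj_within E R)\<^sup>*"
      by (simp add: C_def)
    then show "u \<in> R"
      by (induction rule: rtrancl_induct) (auto simp: \<open>w \<in> R\<close> adj_within_def)
  qed
  have nbrs: "b \<in> C \<union> S" if "c \<in> C" "b \<in> U" "{c, b} \<in> E" for b c
  proof (cases "b \<in> R")
    case True
    then have "(c, b) \<in> adj_within E R"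
      using that CR by (auto simp: adj_within_def)
    then show ?thesis
      using that(1) by (auto simp: C_def)
  next
    case False
    have "b \<noteq> v"
      using that CR by (auto simp: R_def insert_commute)
    then have "{v, b} \<in> E"
      using False that by (auto simp: R_def)
    then show ?thesis
      using that by (auto simp: S_def insert_commute)
  qed
  \<comment> \<open>The edge \<open>{v, s}\<close> has a detour through \<open>t\<close> and then
    \<open>C\<close>. It yields a common neighbour of \<open>v\<close> and \<open>s\<close> in
    \<open>insert t R\<close>; no vertex of \<open>R\<close> is adjacent to \<open>v\<close>, so
    this neighbour is \<open>t\<close>.\<close>
  have S_clique: "{s, t} \<in> E" if st: "s \<in> S" "t \<in> S" "s \<noteq> t" for s t
  proof -
    obtain c d where cd: "c \<in> C" "d \<in> C" "{s, c} \<in> E" "{t, d} \<in> E"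
      using st by (auto simp: S_def)
    have "(d, w) \<in> (adj_within E R)\<^sup>*" "(w, c) \<in> (adj_within E R)\<^sup>*"
      using cd sym_adj_within[of E R] by (auto simp: C_def dest: sym_rtrancl symD)
    then have dc: "(d, c) \<in> (adj_within E R)\<^sup>*"
      by (rule rtrancl_trans)
    have "(adj_within E R)\<^sup>* \<subseteq> (adj_within E (insert t R))\<^sup>*"
      by (rule rtrancl_mono) (auto simp: adj_within_def)
    moreover have "(t, d) \<in> adj_within E (insert t R)"
      using cd CR by (auto simp: adj_within_def)
    ultimately have "(t, c) \<in> (adj_within E (insert t R))\<^sup>*"
      using dc by (meson converse_rtrancl_into_rtrancl subsetD)
    moreover have "{v, s} \<in> E" "{v, t} \<in> E" "{c, s} \<in> E"
      using st cd by (auto simp: S_def insert_commute)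
    moreover have "v \<notin> insert t R" "s \<notin> insert t R"
      using st simple_graph_edgeD[OF sg] by (auto simp: S_def R_def)
    ultimately obtain e where "e \<in> insert t R" "{v, e} \<in> E" "{e, s} \<in> E"
      using chordal_edge_detour_rtrancl[OF sg ch, of v s "insert t R" t c] by blast
    then show ?thesis
      by (auto simp: R_def insert_commute)
  qed
  have lift: ?case if "simplicial_in E (C \<union> S) c" "c \<in> C" for c
  proof (intro exI conjI)
    have "c \<in> U"
      using that CR by (auto simp: R_def)
    then show "simplicial_in E U c"
      using that(1) nbrs[OF that(2)] by (simp add: simplicial_in_def)
    show "c \<noteq> v" "{v, c} \<notin> E"
      using that CR by (auto simp: R_def)
  qed
  have sub: "C \<union> S \<subseteq> U" "v \<notin> C \<union> S"
    using CR simple_graph_edgeD[OF sg] by (auto simp: R_def S_def)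
  have smaller: "card (C \<union> S) < card U" "finite (C \<union> S)"
    using sub less.prems by (auto intro!: psubset_card_mono intro: finite_subset)
  note IH = less.hyps[OF smaller]
  \<comment> \<open>The vertex fed to the induction hypothesis is chosen so that its non-neighbours
    avoid \<open>S\<close>: in the first case because \<open>S\<close> is a clique, in the second
    because each vertex of \<open>S\<close> is adjacent to all others. In the third case
    \<open>C \<union> S\<close> is a clique and \<open>w\<close> itself serves.\<close>
  consider s t where "s \<in> S" "t \<in> C \<union> S" "t \<noteq> s" "{s, t} \<notin> E"
    | c t where "\<And>s t. s \<in> S \<Longrightarrow> t \<in> C \<union> S \<Longrightarrow> t \<noteq> s \<Longrightarrow> {s, t} \<in> E"
        "c \<in> C" "t \<in> C \<union> S" "t \<noteq> c" "{c, t} \<notin> E"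
    | "\<And>s t. s \<in> C \<union> S \<Longrightarrow> t \<in> C \<union> S \<Longrightarrow> t \<noteq> s \<Longrightarrow> {s, t} \<in> E"
    by blast
  then show ?case
  proof cases
    case 1
    then obtain u where u: "simplicial_in E (C \<union> S) u" "u \<noteq> s" "{s, u} \<notin> E"
      using IH[of s t] by auto
    then have "u \<in> C"
      using S_clique[of s u] 1 by (auto simp: simplicial_in_def)
    then show ?thesis
      using lift u by blast
  next
    case 2
    then obtain u where u: "simplicial_in E (C \<union> S) u" "u \<noteq> c" "{c, u} \<notin> E"
      using IH[of c t] by auto
    then have "u \<in> C"
      using 2(1)[of u c] 2(2) by (auto simp: simplicial_in_def insert_commute)
    then show ?thesis
      using lift u by blast
  next
    case 3
    then have "simplicial_in E (C \<union> S) w"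
      using \<open>w \<in> C\<close> unfolding simplicial_in_def by blast
    then show ?thesis
      using lift \<open>w \<in> C\<close> by blast
  qed
qed

lemma chordal_simplicial_exists:
  assumes "simple_graph V E" "chordal E" "finite U" "U \<noteq> {}"
  shows "\<exists>v. simplicial_in E U v"
proof (cases "\<exists>v\<in>U. \<exists>w\<in>U. w \<noteq> v \<and> {v, w} \<notin> E")
  case True
  then obtain v w where "v \<in> U" "w \<in> U" "w \<noteq> v" "{v, w} \<notin> E"
    by blast
  from chordal_simplicial_nonneighbour[OF assms(1-3) this] show ?thesis
    by blast
next
  case False
  obtain v where "v \<in> U"
    using assms(4) by blast
  with False have "simplicial_in E U v"
    by (auto simp: simplicial_in_def)
  then show ?thesis ..
qed

section \<open>Cliques that separate the square\<close>

lemma removal_disconnectsI: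
  assumes "p \<in> P" "q \<notin> P" "p \<in> V - W" "q \<in> V - W"
    and closed: "\<And>u v. u \<in> P - W \<Longrightarrow> v \<in> V - W \<Longrightarrow> {u, v} \<in> E \<Longrightarrow> v \<in> P"
  shows "removal_disconnects V E W"
  unfolding removal_disconnects_def
proof
  assume "graph_connected (V - W) (edges_avoiding E W)"
  then obtain xs where xs: "walk (V - W) (edges_avoiding E W) xs" "hd xs = p" "last xs = q"
    using assms unfolding graph_connected_def by blast
  have "last xs \<in> P" if "xs \<noteq> []" "set xs \<subseteq> V - W" "hd xs \<in> P"
    "successively (\<lambda>u v. {u, v} \<in> edges_avoiding E W) xs" for xs
    using that
  proof (induction xs)
    case (Cons u xs)
    show ?case
    proof (cases xs)
      case (Cons v ys)
      then have "v \<in> P"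
        using Cons.prems closed[of u v] by (auto simp: edges_avoiding_def)
      then show ?thesis
        using Cons.prems Cons.IH Cons by simp
    qed (use Cons.prems in simp)
  qed simp
  then show False
    using xs assms by (auto simp: walk_def)
qed

lemma vdegree_eq_card_neighbours:
  assumes "simple_graph V E"
  shows "vdegree E x = card {u. {x, u} \<in> E}"
proof -
  have "bij_betw (\<lambda>u. {x, u}) {u. {x, u} \<in> E} {e \<in> E. x \<in> e}"
    unfolding bij_betw_def
  proof (intro conjI set_eqI iffI)
    show "inj_on (\<lambda>u. {x, u}) {u. {x, u} \<in> E}"
      by (auto simp: inj_on_def doubleton_eq_iff)
  next
    fix e assume "e \<in> {e \<in> E. x \<in> e}"
    then have "e \<in> E" "x \<in> e" "card e = 2"
      using assms by (auto simp: simple_graph_def)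
    then obtain u where "e = {x, u}"
      by (auto simp: card_2_iff)
    then show "e \<in> (\<lambda>u. {x, u}) ` {u. {x, u} \<in> E}"
      using \<open>e \<in> E\<close> by blast
  qed auto
  then show ?thesis
    unfolding vdegree_def by (simp add: bij_betw_same_card)
qed

text \<open>The candidates are the closed neighbourhood of \<open>x\<close> and the same set without
  \<open>a\<close> or without \<open>b\<close>. Since \<open>y\<close>, \<open>z\<close>,
  \<open>a\<close>, \<open>b\<close> are distinct neighbours of \<open>x\<close> and its degree is
  at most 6, their sizes lie between 4 and 7.\<close>

lemma separator_at_degree_two_triangle:
  assumes fin: "finite V" and sg: "simple_graph V E" and ch: "chordal E"
    and xyz: "{x, y} \<in> E" "{x, z} \<in> E" "{y, z} \<in> E"
    and a: "{x, a} \<in> E" "{y, a} \<in> E" "a \<noteq> z"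
    and b: "{x, b} \<in> E" "{z, b} \<in> E" "b \<noteq> y"
    and only: "\<And>c. {y, c} \<in> E \<Longrightarrow> {c, z} \<in> E \<Longrightarrow> c = x"
    and deg: "vdegree E x \<le> 6"
  shows "clique V (square_edges V E) \<or> (\<exists>h \<in> {4, 5, 6, 7}. \<exists>W F. separator V E h W F)"
proof -
  note edgeD = simple_graph_edgeD[OF sg]
  note sq = square_edges_iff[OF sg]
  define N where "N = {u. {x, u} \<in> E}"
  define R where "R = V - {x, y, z}"
  \<comment> \<open>With this split \<open>y\<close> has no neighbour in \<open>B\<close> by
    construction, and \<open>z\<close> will have none in \<open>A\<close> by chordality.\<close>
  define A where "A = {c. \<exists>n\<in>R. {y, n} \<in> E \<and> (n, c) \<in> (adj_within E R)\<^sup>*}"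
  define B where "B = R - A"
  have NV: "N \<subseteq> V" "x \<notin> N"
    using edgeD(2) edgeD(3)[of x x] by (auto simp: N_def)
  then have finN: "finite N"
    using fin finite_subset by blast
  have "a \<noteq> b"
    using only[of a] a b edgeD[OF a(1)] by (auto simp: insert_commute)
  then have "card {y, z, a, b} = 4"
    using a b edgeD[OF a(2)] edgeD[OF b(2)] edgeD[OF xyz(3)] by auto
  moreover have "{y, z, a, b} \<subseteq> N"
    using a b xyz by (auto simp: N_def)
  ultimately have N4: "4 \<le> card N"
    using card_mono[OF finN] by metis
  have N6: "card N \<le> 6"
    using deg vdegree_eq_card_neighbours[OF sg] by (simp add: N_def)
  have cliqueN: "clique (insert x N) (square_edges V E)"
    unfolding clique_def sq using NV edgeD[OF a(1)] by (auto simp: N_def insert_commute)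
  have AR: "A \<subseteq> R"
  proof
    fix c assume "c \<in> A"
    then obtain n where "n \<in> R" "(n, c) \<in> (adj_within E R)\<^sup>*"
      by (auto simp: A_def)
    from this(2) this(1) show "c \<in> R"
      by (induction rule: rtrancl_induct) (auto simp: adj_within_def)
  qed
  have AB: "d \<in> A" if cd: "c \<in> A" "d \<in> R" "{c, d} \<in> E" for c d
  proof -
    obtain n where n: "n \<in> R" "{y, n} \<in> E" "(n, c) \<in> (adj_within E R)\<^sup>*"
      using cd by (auto simp: A_def)
    moreover have "(c, d) \<in> adj_within E R"
      using that AR by (auto simp: adj_within_def)
    ultimately have "(n, d) \<in> (adj_within E R)\<^sup>*"
      by simp
    then show ?thesis
      using n unfolding A_def by blast
  qed
  have yB: "{y, c} \<notin> E" if "c \<in> B" for c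
    using that unfolding B_def A_def by auto
  \<comment> \<open>An edge from \<open>A\<close> to \<open>z\<close> would complete a detour around
    \<open>{y, z}\<close> and so produce a common neighbour of \<open>y\<close> and \<open>z\<close>
    in \<open>R\<close>, against \<open>only\<close>.\<close>
  have zA: "{c, z} \<notin> E" if cA: "c \<in> A" for c
  proof
    assume cz: "{c, z} \<in> E"
    obtain n where n: "n \<in> R" "{y, n} \<in> E" "(n, c) \<in> (adj_within E R)\<^sup>*"
      using cA by (auto simp: A_def)
    have "y \<notin> R" "z \<notin> R"
      by (auto simp: R_def)
    from chordal_edge_detour_rtrancl[OF sg ch xyz(3) this n(2,1,3) cz]
    obtain e where "e \<in> R" "{y, e} \<in> E" "{e, z} \<in> E"
      by blast
    with only show False
      by (auto simp: R_def)
  qed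
  have "a \<in> R"
    using a edgeD[OF a(1)] edgeD[OF a(2)] by (auto simp: R_def)
  then have "a \<in> A"
    using a unfolding A_def by blast
  have "b \<in> R"
    using b edgeD[OF b(1)] edgeD[OF b(2)] by (auto simp: R_def)
  then have "b \<in> B"
    using b zA[of b] by (auto simp: B_def insert_commute)
  \<comment> \<open>A square edge from \<open>A\<close> to \<open>B\<close> needs a middle vertex
    outside \<open>R\<close>. This is neither \<open>y\<close> nor \<open>z\<close>, hence
    \<open>x\<close>, so both ends would be in \<open>N\<close>.\<close>
  have cross: "v \<in> A" if uv: "u \<in> A" "v \<in> R" "{u, v} \<in> square_edges V E" "u \<notin> N \<or> v \<notin> N" for u v
  proof (rule ccontr)
    assume "v \<notin> A"
    with that have "v \<in> B"
      by (simp add: B_def)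
    have "{u, v} \<notin> E"
      using AB that \<open>v \<notin> A\<close> by blast
    then obtain w where w: "{u, w} \<in> E" "{w, v} \<in> E"
      using uv(3) sq by blast
    then have "w \<notin> R"
      using AB that \<open>v \<notin> A\<close> by blast
    then have "w \<in> {x, y, z}"
      using edgeD(2)[OF w(1)] by (auto simp: R_def)
    moreover have "w \<noteq> x"
      using that w by (auto simp: N_def insert_commute)
    moreover have "w \<noteq> y" "w \<noteq> z"
      using yB[OF \<open>v \<in> B\<close>] zA[OF that(1)] w by auto
    ultimately show False
      by blast
  qed
  have VN: "v \<in> R" if "v \<in> V" "v \<notin> insert x N" for v
    using that xyz by (auto simp: R_def N_def)
  have sepI: ?thesis if "clique W (square_edges V E)" "W \<subseteq> V" "card W \<in> {4, 5, 6, 7}"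
    "removal_disconnects V (square_edges V E) W" for W
  proof -
    \<comment> \<open>Any subgraph on \<open>W\<close> will do; the edgeless one is taken.\<close>
    have "separator V E (card W) W {}"
      using that by (simp add: separator_def subgraph_def simple_graph_def)
    then show ?thesis
      using that(3) by blast
  qed
  have xV: "x \<in> V"
    using edgeD[OF xyz(1)] by simp
  have WV: "insert x N \<subseteq> V" "card (insert x N) = Suc (card N)"
    using NV finN xV by auto
  consider p q where "p \<in> A - N" "q \<in> B - N" | q where "A \<subseteq> N" "q \<in> B - N"
    | p where "B \<subseteq> N" "p \<in> A - N" | "A \<subseteq> N" "B \<subseteq> N"
    by blast
  then show ?thesis
  proof cases
    case 1
    have "removal_disconnects V (square_edges V E) (insert x N)"
    proof (rule removal_disconnectsI)
      show "p \<in> A" "q \<notin> A" "p \<in> V - insert x N" "q \<in> V - insert x N"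
        using 1 AR by (auto simp: B_def R_def)
      show "v \<in> A" if "u \<in> A - insert x N" "v \<in> V - insert x N" "{u, v} \<in> square_edges V E" for u v
        using cross[of u v] VN[of v] that by blast
    qed
    then show ?thesis
      using WV N4 N6 cliqueN by (intro sepI) auto
  next
    case 2
    \<comment> \<open>Deleting all of \<open>insert x N\<close> would leave nothing of
      \<open>A\<close>. With \<open>a\<close> put back, the remaining part of \<open>A\<close> is
      just \<open>a\<close>, and every other remaining vertex lies outside \<open>N\<close>, so
      \<open>cross\<close> applies.\<close>
    have "removal_disconnects V (square_edges V E) (insert x N - {a})"
    proof (rule removal_disconnectsI)
      show "a \<in> A" "q \<notin> A" "a \<in> V - (insert x N - {a})" "q \<in> V - (insert x N - {a})"
        using 2 AR \<open>a \<in> A\<close> by (auto simp: B_def R_def)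
      show "v \<in> A" if uv: "u \<in> A - (insert x N - {a})" "v \<in> V - (insert x N - {a})"
        "{u, v} \<in> square_edges V E" for u v
      proof (cases "v = a")
        case False
        then show ?thesis
          using cross[of u v] VN[of v] uv by blast
      qed (simp add: \<open>a \<in> A\<close>)
    qed
    moreover have "card (insert x N - {a}) = card N"
      using a WV finN by (subst card_Diff_singleton) (auto simp: N_def)
    ultimately show ?thesis
      using WV N4 N6 cliqueN by (intro sepI) (auto elim: smaller_clique)
  next
    case 3
    \<comment> \<open>Now \<open>b\<close> is put back. The remaining vertices of \<open>A\<close>
      lie outside \<open>N\<close>, so by \<open>cross\<close> they have no square edge even to
      \<open>b\<close>.\<close>
    have "removal_disconnects V (square_edges V E) (insert x N - {b})"
    proof (rule removal_disconnectsI)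
      show "p \<in> A" "b \<notin> A" "p \<in> V - (insert x N - {b})" "b \<in> V - (insert x N - {b})"
        using 3 AR \<open>b \<in> B\<close> by (auto simp: B_def R_def)
      show "v \<in> A" if uv: "u \<in> A - (insert x N - {b})" "v \<in> V - (insert x N - {b})"
        "{u, v} \<in> square_edges V E" for u v
      proof -
        have "u \<notin> N"
          using uv(1) \<open>b \<in> B\<close> AR by (auto simp: B_def R_def)
        moreover have "v \<in> R"
          using VN[of v] uv(2) \<open>b \<in> R\<close> by blast
        ultimately show ?thesis
          using cross[of u v] uv by blast
      qed
    qed
    moreover have "card (insert x N - {b}) = card N"
      using b WV finN by (subst card_Diff_singleton) (auto simp: N_def)
    ultimately show ?thesis
      using WV N4 N6 cliqueN by (intro sepI) (auto elim: smaller_clique)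
  next
    case 4
    then have "V \<subseteq> insert x N"
      using xyz by (auto simp: N_def B_def R_def)
    then show ?thesis
      using cliqueN smaller_clique by blast
  qed
qed

section \<open>Jordan curves and nonseparating sets\<close>

text \<open>The parametrization is forgotten, so that drawn edges can be reversed and joined as mere
  sets.\<close>

definition arc_set :: "complex set \<Rightarrow> complex \<Rightarrow> complex \<Rightarrow> bool" where
  "arc_set S a b \<longleftrightarrow> (\<exists>g. arc g \<and> pathstart g = a \<and> pathfinish g = b \<and> path_image g = S)"

definition jordan_set :: "complex set \<Rightarrow> bool" where
  "jordan_set S \<longleftrightarrow> (\<exists>g. simple_path g \<and> pathfinish g = pathstart g \<and> path_image g = S)"

definition filling :: "complex set \<Rightarrow> complex set" where
  "filling S = S \<union> inside S"

definition nonseparating :: "complex set \<Rightarrow> bool" where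
  "nonseparating X \<longleftrightarrow> compact X \<and> connected (- X)"

lemma arc_set_sym: "arc_set S a b \<Longrightarrow> arc_set S b a"
  unfolding arc_set_def
  by (metis arc_reversepath path_image_reversepath pathfinish_reversepath pathstart_reversepath)

lemma arc_set_ends: "arc_set S a b \<Longrightarrow> a \<in> S \<and> b \<in> S \<and> a \<noteq> b"
  unfolding arc_set_def using arc_distinct_ends by fastforce

lemma arc_set_connected: "arc_set S a b \<Longrightarrow> connected S"
  unfolding arc_set_def by (metis arc_imp_path connected_path_image)

lemma arc_set_join:
  assumes "arc_set S a b" "arc_set T b c" "S \<inter> T \<subseteq> {b}"
  shows "arc_set (S \<union> T) a c"
proof -
  obtain g h where "arc g" "pathstart g = a" "pathfinish g = b" "path_image g = S"
    "arc h" "pathstart h = b" "pathfinish h = c" "path_image h = T"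
    using assms unfolding arc_set_def by metis
  then show ?thesis
    unfolding arc_set_def using assms(3)
    by (intro exI[of _ "g +++ h"]) (auto simp: arc_join path_image_join)
qed

lemma jordan_set_join:
  assumes "arc_set S a b" "arc_set T a b" "S \<inter> T \<subseteq> {a, b}"
  shows "jordan_set (S \<union> T)"
proof -
  obtain g h where "arc g" "pathstart g = a" "pathfinish g = b" "path_image g = S"
    "arc h" "pathstart h = b" "pathfinish h = a" "path_image h = T"
    using assms(1) arc_set_sym[OF assms(2)] unfolding arc_set_def by metis
  then show ?thesis
    unfolding jordan_set_def using assms(3)
    by (intro exI[of _ "g +++ h"]) (auto simp: simple_path_join_loop path_image_join)
qed

lemma arc_set_interior_point:
  assumes "arc_set S a b"
  obtains m where "m \<in> S" "m \<noteq> a" "m \<noteq> b"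
proof -
  obtain g where g: "arc g" "pathstart g = a" "pathfinish g = b" "path_image g = S"
    using assms unfolding arc_set_def by blast
  then have "inj_on g {0..1}"
    by (simp add: arc_def)
  then have "g (1/2) \<noteq> g 0" "g (1/2) \<noteq> g 1"
    using inj_on_eq_iff[of g "{0..1}" "1/2" 0] inj_on_eq_iff[of g "{0..1}" "1/2" 1] by auto
  moreover have "g (1/2) \<in> S"
    using g by (auto simp: path_image_def)
  ultimately show ?thesis
    using g that by (simp add: pathstart_def pathfinish_def)
qed

text \<open>Allows an edge to be cut at ends that lie on a Jordan curve while the rest stays
  connected and hence on one side of the curve.\<close>

lemma connected_arc_set_minus_ends:
  assumes "arc_set S a b"
  shows "connected (S - {a})" "connected (S - {b})" "connected (S - {a, b})"
proof -
  have half: "connected (S - {a})" if ab: "arc_set S a b" for a b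
  proof -
    obtain g where g: "arc g" "pathstart g = a" "pathfinish g = b" "path_image g = S"
      using ab unfolding arc_set_def by blast
    then have inj: "inj_on g {0..1}" and cont: "continuous_on {0..1} g"
      by (auto simp: arc_def path_def)
    have "S - {a} = g ` {0<..1}"
    proof -
      have "g ` {0..1} - g ` {0} = g ` ({0..1} - {0})"
        using inj by (intro inj_on_image_set_diff[symmetric]) auto
      moreover have "{0..1} - {0} = {0<..1::real}"
        by auto
      ultimately show ?thesis
        using g by (auto simp: path_image_def pathstart_def)
    qed
    moreover have "connected (g ` {0<..1})"
      by (intro connected_continuous_image continuous_on_subset[OF cont] connected_Ioc) auto
    ultimately show ?thesis
      by simp
  qed
  show "connected (S - {a})" "connected (S - {b})"
    using half assms arc_set_sym by blast+
  show "connected (S - {a, b})"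
    using assms connected_simple_path_endless arc_imp_simple_path unfolding arc_set_def by metis
qed

lemma jordan_setD:
  assumes "jordan_set S"
  shows "inside S \<noteq> {}" "open (inside S)" "connected (inside S)" "bounded (inside S)"
    "connected (outside S)" "frontier (inside S) = S" "compact S" "open (outside S)"
proof -
  obtain g where "simple_path g" "pathfinish g = pathstart g" "path_image g = S"
    using assms unfolding jordan_set_def by blast
  then show "inside S \<noteq> {}" "open (inside S)" "connected (inside S)" "bounded (inside S)"
    "connected (outside S)" "frontier (inside S) = S" "compact S" "open (outside S)"
    using Jordan_inside_outside[of g] compact_simple_path_image[of g] by auto
qed

section \<open>Compact sets that do not separate the plane\<close>

lemma nonseparating_filling:
  assumes "jordan_set S"
  shows "nonseparating (filling S)"
proof -
  have "filling S = - outside S"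
    by (simp add: filling_def union_with_inside)
  moreover have "bounded (filling S)"
    using jordan_setD[OF assms] by (simp add: filling_def compact_imp_bounded)
  ultimately show ?thesis
    using jordan_setD[OF assms] by (simp add: nonseparating_def compact_eq_bounded_closed closed_Compl)
qed

text \<open>Janiszewski's theorem, used to glue pieces along a connected overlap.\<close>

lemma nonseparating_Un:
  assumes "nonseparating X" "nonseparating Y" "connected (X \<inter> Y)"
  shows "nonseparating (X \<union> Y)"
  using assms Janiszewski_connected[of X Y]
  by (simp add: nonseparating_def compact_Un compact_imp_closed)

lemma connected_subset_inside:
  assumes "jordan_set S" "connected C" "C \<inter> S = {}" "C \<inter> inside S \<noteq> {}"
  shows "C \<subseteq> inside S"
  using connected_Int_frontier[of C "inside S"] jordan_setD[OF assms(1)] assms by auto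

lemma nonseparating_Compl_unbounded:
  assumes "nonseparating X"
  shows "\<not> bounded (- X)"
proof
  assume "bounded (- X)"
  moreover have "bounded X"
    using assms by (simp add: nonseparating_def compact_imp_bounded)
  ultimately have "bounded (X \<union> - X)"
    by (simp only: bounded_Un)
  then show False
    using not_bounded_UNIV[where 'a=complex] by simp
qed

text \<open>Otherwise the connected set \<open>- X\<close> contains the inside of \<open>S\<close>
  and avoids \<open>S\<close>, so it lies wholly inside \<open>S\<close>; but the complement of a
  compact set is unbounded.\<close>

lemma nonseparating_meets_inside:
  assumes "nonseparating X" "jordan_set S" "S \<subseteq> X"
  shows "inside S \<inter> X \<noteq> {}"
proof
  assume "inside S \<inter> X = {}"
  then have "- X \<inter> inside S \<noteq> {}"
    using jordan_setD(1)[OF assms(2)] by blast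
  then have "- X \<subseteq> inside S"
    using assms by (intro connected_subset_inside) (auto simp: nonseparating_def)
  then show False
    using jordan_setD(4)[OF assms(2)] nonseparating_Compl_unbounded[OF assms(1)] bounded_subset by blast
qed

lemma nonseparating_arc_set: "arc_set S a b \<Longrightarrow> nonseparating S"
  unfolding arc_set_def nonseparating_def
  using compact_arc_image connected_arc_complement by fastforce

lemma nonseparating_singleton: "nonseparating {z}"
  unfolding nonseparating_def using connected_punctured_universe[of z] by simp

lemma inside_in_components:
  assumes "jordan_set S" "S \<subseteq> D" "inside S \<inter> D = {}"
  shows "inside S \<in> components (- D)"
  unfolding in_components_maximal
proof (intro conjI allI impI)
  fix C assume C: "C \<noteq> {} \<and> inside S \<subseteq> C \<and> C \<subseteq> - D \<and> connected C"
  then have "C \<subseteq> inside S"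
    using assms jordan_setD[OF assms(1)] by (intro connected_subset_inside) auto
  then show "C = inside S"
    using C by blast
qed (use assms jordan_setD[OF assms(1)] in auto)

text \<open>Both insides are components of \<open>- D\<close>, and each curve is the frontier of its
  inside, so different curves give different components.\<close>

lemma inside_disjoint:
  assumes "jordan_set S" "jordan_set T" "S \<noteq> T" "S \<subseteq> D" "T \<subseteq> D"
    and "inside S \<inter> D = {}" "inside T \<inter> D = {}"
  shows "inside S \<inter> inside T = {}"
proof -
  have "inside S \<noteq> inside T"
    using jordan_setD(6) assms by metis
  then show ?thesis
    using components_nonoverlap inside_in_components assms by metis
qed

text \<open>If none of the three arcs met the region bounded by the other two, the three regions would be
  distinct faces, so filling two of them would leave the third one as a bounded piece of a
  connected unbounded complement.\<close>

lemma theta_arc_inside: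
  assumes arcs: "arc_set c1 p q" "arc_set c2 p q" "arc_set c3 p q"
    and Int: "c1 \<inter> c2 \<subseteq> {p, q}" "c1 \<inter> c3 \<subseteq> {p, q}" "c2 \<inter> c3 \<subseteq> {p, q}"
  shows "c1 \<inter> inside (c2 \<union> c3) \<noteq> {} \<or> c2 \<inter> inside (c1 \<union> c3) \<noteq> {} \<or> c3 \<inter> inside (c1 \<union> c2) \<noteq> {}"
proof (rule ccontr)
  assume contra: "\<not> ?thesis"
  let ?D = "c1 \<union> c2 \<union> c3"
  have J: "jordan_set (c1 \<union> c2)" "jordan_set (c1 \<union> c3)" "jordan_set (c2 \<union> c3)"
    using jordan_set_join arcs Int by blast+
  have D: "inside (c1 \<union> c2) \<inter> ?D = {}" "inside (c1 \<union> c3) \<inter> ?D = {}" "inside (c2 \<union> c3) \<inter> ?D = {}"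
    using contra inside_no_overlap[of "c1 \<union> c2"] inside_no_overlap[of "c1 \<union> c3"]
      inside_no_overlap[of "c2 \<union> c3"] by blast+
  have ends: "p \<in> c1" "q \<in> c1" "p \<in> c2" "q \<in> c2" "p \<in> c3" "q \<in> c3"
    using arc_set_ends arcs by blast+
  obtain m1 where m1: "m1 \<in> c1" "m1 \<noteq> p" "m1 \<noteq> q"
    using arc_set_interior_point[OF arcs(1)] .
  obtain m2 where m2: "m2 \<in> c2" "m2 \<noteq> p" "m2 \<noteq> q"
    using arc_set_interior_point[OF arcs(2)] .
  have ne: "c1 \<union> c2 \<noteq> c1 \<union> c3" "c1 \<union> c2 \<noteq> c2 \<union> c3" "c1 \<union> c3 \<noteq> c2 \<union> c3"
    using m1 m2 Int by blast+
  have disj: "inside (c1 \<union> c2) \<inter> inside (c1 \<union> c3) = {}"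
    "inside (c1 \<union> c2) \<inter> inside (c2 \<union> c3) = {}" "inside (c1 \<union> c3) \<inter> inside (c2 \<union> c3) = {}"
    by (rule inside_disjoint[where D = ?D]; use J D ne in blast)+
  have "filling (c1 \<union> c2) \<inter> filling (c1 \<union> c3) = c1"
    using disj D Int ends unfolding filling_def by blast
  then have "nonseparating (filling (c1 \<union> c2) \<union> filling (c1 \<union> c3))"
    using J arcs by (intro nonseparating_Un nonseparating_filling) (auto simp: arc_set_connected)
  then have "inside (c2 \<union> c3) \<inter> (filling (c1 \<union> c2) \<union> filling (c1 \<union> c3)) \<noteq> {}"
    using J by (intro nonseparating_meets_inside) (auto simp: filling_def)
  then show False
    using disj D unfolding filling_def by blast
qed

section \<open>Faces of chordal outerplane graphs\<close>

locale outerplane =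
  fixes V :: "'a set" and E :: "'a set set"
    and \<phi> :: "'a \<Rightarrow> complex" and \<gamma> :: "'a set \<Rightarrow> real \<Rightarrow> complex"
  assumes fin: "finite V" and sg: "simple_graph V E"
    and emb: "outerplane_embedding V E \<phi> \<gamma>"
begin

abbreviation P :: "'a set \<Rightarrow> complex set" where
  "P e \<equiv> path_image (\<gamma> e)"

abbreviation D :: "complex set" where
  "D \<equiv> drawing V E \<phi> \<gamma>"

definition triangle :: "'a set \<Rightarrow> bool" where
  "triangle t \<longleftrightarrow> t \<subseteq> V \<and> card t = 3 \<and> clique t E"

text \<open>Allowed for every vertex set: for a triangle it is a Jordan curve, in general it
  consists of the drawn edges of the induced subgraph.\<close>

definition boundary :: "'a set \<Rightarrow> complex set" where
  "boundary t = (\<Union>e\<in>{e \<in> E. e \<subseteq> t}. P e)"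

lemma inj_phi: "inj_on \<phi> V"
  using emb by (simp add: outerplane_embedding_def plane_embedding_def)

lemma P_Int: "e \<in> E \<Longrightarrow> e' \<in> E \<Longrightarrow> e \<noteq> e' \<Longrightarrow> P e \<inter> P e' = \<phi> ` (e \<inter> e')"
  using emb by (simp add: outerplane_embedding_def plane_embedding_def)

lemma P_Int_V: "e \<in> E \<Longrightarrow> P e \<inter> \<phi> ` V = \<phi> ` e"
  using emb by (simp add: outerplane_embedding_def plane_embedding_def)

lemma P_subset_D: "e \<in> E \<Longrightarrow> P e \<subseteq> D"
  by (auto simp: drawing_def)

lemma boundary_subset_D: "boundary t \<subseteq> D"
  by (auto simp: boundary_def drawing_def)

lemma edge_subset: "e \<in> E \<Longrightarrow> e \<subseteq> V"
  using sg by (simp add: simple_graph_def)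

lemma edge_eq_doubleton: "e \<in> E \<Longrightarrow> e \<subseteq> {a, b} \<Longrightarrow> e = {a, b}"
  using sg unfolding simple_graph_def by (metis card_2_iff doubleton_eq_iff insert_subset
      singletonD insertE)

lemma arc_set_edge:
  assumes "{a, b} \<in> E"
  shows "arc_set (P {a, b}) (\<phi> a) (\<phi> b)"
proof -
  have g: "arc (\<gamma> {a, b})" "{pathstart (\<gamma> {a, b}), pathfinish (\<gamma> {a, b})} = {\<phi> a, \<phi> b}"
    using emb assms by (simp_all add: outerplane_embedding_def plane_embedding_def)
  then have "arc_set (P {a, b}) (pathstart (\<gamma> {a, b})) (pathfinish (\<gamma> {a, b}))"
    by (auto simp: arc_set_def)
  then show ?thesis
    using g(2) arc_set_sym by (auto simp: doubleton_eq_iff)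
qed

lemma arc_set_two_edges:
  assumes "{a, b} \<in> E" "{b, c} \<in> E" "a \<noteq> c"
  shows "arc_set (P {a, b} \<union> P {b, c}) (\<phi> a) (\<phi> c)"
proof -
  have "{a, b} \<noteq> {b, c}"
    using assms(3) by (auto simp: doubleton_eq_iff)
  then have "P {a, b} \<inter> P {b, c} = \<phi> ` ({a, b} \<inter> {b, c})"
    using assms P_Int by blast
  moreover have "{a, b} \<inter> {b, c} = {b}"
    using assms(3) simple_graph_edgeD(3)[OF sg assms(1)] by auto
  ultimately show ?thesis
    using assms by (intro arc_set_join[OF arc_set_edge arc_set_edge]) auto
qed

lemma triangleE:
  assumes "triangle t"
  obtains u v w where "t = {u, v, w}" "u \<noteq> v" "u \<noteq> w" "v \<noteq> w"
    "{u, v} \<in> E" "{u, w} \<in> E" "{v, w} \<in> E"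
  using assms unfolding triangle_def clique_def card_3_iff by blast

lemma triangleI:
  assumes "{u, v} \<in> E" "{u, w} \<in> E" "{v, w} \<in> E"
  shows "triangle {u, v, w}"
  using assms simple_graph_edgeD[OF sg]
  by (auto simp: triangle_def clique_def insert_commute)

lemma boundary_eq:
  assumes "{u, v} \<in> E" "{u, w} \<in> E" "{v, w} \<in> E"
  shows "boundary {u, v, w} = P {u, v} \<union> P {u, w} \<union> P {v, w}"
proof
  show "boundary {u, v, w} \<subseteq> P {u, v} \<union> P {u, w} \<union> P {v, w}"
  proof
    fix z assume "z \<in> boundary {u, v, w}"
    then obtain e where e: "e \<in> E" "e \<subseteq> {u, v, w}" "z \<in> P e"
      by (auto simp: boundary_def)
    obtain a b where "e = {a, b}" "a \<noteq> b"
      using sg e unfolding simple_graph_def by (metis card_2_iff)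
    then have "e = {u, v} \<or> e = {u, w} \<or> e = {v, w}"
      using e by (auto simp: doubleton_eq_iff)
    then show "z \<in> P {u, v} \<union> P {u, w} \<union> P {v, w}"
      using e(3) by blast
  qed
qed (use assms in \<open>auto simp: boundary_def\<close>)

lemma jordan_boundary:
  assumes "triangle t"
  shows "jordan_set (boundary t)"
proof -
  obtain u v w where t: "t = {u, v, w}" "u \<noteq> v" "u \<noteq> w" "v \<noteq> w"
    "{u, v} \<in> E" "{u, w} \<in> E" "{v, w} \<in> E"
    using triangleE[OF assms] .
  have "P {u, v} \<inter> P {v, w} = \<phi> ` ({u, v} \<inter> {v, w})" "P {u, w} \<inter> P {v, w} = \<phi> ` ({u, w} \<inter> {v, w})"
    by (rule P_Int; use t in \<open>auto simp: doubleton_eq_iff\<close>)+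
  moreover have "P {u, v} \<inter> P {u, w} = \<phi> ` ({u, v} \<inter> {u, w})"
    by (rule P_Int; use t in \<open>auto simp: doubleton_eq_iff\<close>)
  ultimately have "(P {u, v} \<union> P {v, w}) \<inter> P {u, w} \<subseteq> {\<phi> u, \<phi> w}"
    using t by auto
  then have "jordan_set ((P {u, v} \<union> P {v, w}) \<union> P {u, w})"
    by (rule jordan_set_join[OF arc_set_two_edges[OF t(5,7,3)] arc_set_edge[OF t(6)]])
  then show ?thesis
    using boundary_eq t by (simp add: Un_ac)
qed

lemma boundary_Int_V:
  assumes "triangle t"
  shows "boundary t \<inter> \<phi> ` V = \<phi> ` t"
proof -
  obtain u v w where t: "t = {u, v, w}" "{u, v} \<in> E" "{u, w} \<in> E" "{v, w} \<in> E"
    using triangleE[OF assms] by metis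
  then show ?thesis
    using P_Int_V[OF t(2)] P_Int_V[OF t(3)] P_Int_V[OF t(4)] by (auto simp: boundary_eq)
qed

lemma boundary_inject:
  assumes "triangle t" "triangle t'" "boundary t = boundary t'"
  shows "t = t'"
proof -
  have "\<phi> ` t = \<phi> ` t'"
    using assms boundary_Int_V by metis
  then show ?thesis
    using assms inj_phi inj_on_image_eq_iff unfolding triangle_def by metis
qed

text \<open>Every vertex is on the frontier of the unbounded face. A vertex inside \<open>S\<close>
  would pull that face into the inside of \<open>S\<close>, since the face is connected and avoids
  \<open>S\<close>; but the inside is bounded.\<close>

lemma vertex_notin_inside:
  assumes "jordan_set S" "S \<subseteq> D" "v \<in> V"
  shows "\<phi> v \<notin> inside S"
proof
  assume v: "\<phi> v \<in> inside S"
  obtain F where F: "F \<in> components (- D)" "\<not> bounded F" "\<phi> ` V \<subseteq> frontier F"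
    using emb by (auto simp: outerplane_embedding_def faces_def)
  have "F \<inter> inside S \<noteq> {}"
  proof -
    have "\<phi> v \<in> closure F"
      using F(3) assms(3) by (auto simp: frontier_def)
    then show ?thesis
      using v jordan_setD(2)[OF assms(1)] by (metis open_Int_closure_eq_empty disjoint_iff inf_commute)
  qed
  moreover have "connected F" "F \<subseteq> - D"
    using in_components_connected[OF F(1)] in_components_subset[OF F(1)] by auto
  ultimately have "F \<subseteq> inside S"
    using assms by (intro connected_subset_inside) auto
  then show False
    using F(2) jordan_setD(4)[OF assms(1)] bounded_subset by blast
qed

text \<open>An edge entering the inside is not an edge of \<open>t\<close>, so it meets the curve at
  most in one of its ends. Without that end it stays connected and lies wholly inside, together with
  its other end, against \<open>vertex_notin_inside\<close>.\<close>

lemma inside_triangle_Int_D: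
  assumes "triangle t"
  shows "inside (boundary t) \<inter> D = {}"
proof -
  note J = jordan_boundary[OF assms]
  have edge: False if z: "z \<in> inside (boundary t)" "z \<in> P e" "e \<in> E" for z e
  proof -
    obtain a b where ab: "e = {a, b}" "a \<in> V" "b \<in> V"
      using sg z(3) unfolding simple_graph_def by (metis card_2_iff insert_subset)
    have arc: "arc_set (P e) (\<phi> a) (\<phi> b)"
      using arc_set_edge z(3) ab by blast
    have out: "\<phi> a \<notin> inside (boundary t)" "\<phi> b \<notin> inside (boundary t)"
      using vertex_notin_inside[OF J boundary_subset_D] ab by auto
    have zab: "z \<noteq> \<phi> a" "z \<noteq> \<phi> b"
      using out z by auto
    have "\<not> e \<subseteq> t"
    proof
      assume "e \<subseteq> t"
      then have "z \<in> boundary t"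
        using z by (auto simp: boundary_def)
      then show False
        using z(1) inside_no_overlap by blast
    qed
    have Int: "boundary t \<inter> P e \<subseteq> \<phi> ` (t \<inter> e)"
    proof
      fix w assume "w \<in> boundary t \<inter> P e"
      then obtain e' where e': "e' \<in> E" "e' \<subseteq> t" "w \<in> P e'" "w \<in> P e"
        by (auto simp: boundary_def)
      then have "w \<in> \<phi> ` (e' \<inter> e)"
        using P_Int[OF e'(1) z(3)] \<open>\<not> e \<subseteq> t\<close> by blast
      then show "w \<in> \<phi> ` (t \<inter> e)"
        using e'(2) by blast
    qed
    consider "a \<notin> t" | "b \<notin> t"
      using \<open>\<not> e \<subseteq> t\<close> ab by blast
    then show False
    proof cases
      case 1
      then have "(P e - {\<phi> b}) \<inter> boundary t = {}"
        using Int ab by auto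
      moreover have "(P e - {\<phi> b}) \<inter> inside (boundary t) \<noteq> {}"
        using z zab by blast
      ultimately have "P e - {\<phi> b} \<subseteq> inside (boundary t)"
        using connected_subset_inside[OF J] connected_arc_set_minus_ends[OF arc] by blast
      moreover have "\<phi> a \<in> P e - {\<phi> b}"
        using arc_set_ends[OF arc] by simp
      ultimately show ?thesis
        using out(1) by blast
    next
      case 2
      then have "(P e - {\<phi> a}) \<inter> boundary t = {}"
        using Int ab by auto
      moreover have "(P e - {\<phi> a}) \<inter> inside (boundary t) \<noteq> {}"
        using z zab by blast
      ultimately have "P e - {\<phi> a} \<subseteq> inside (boundary t)"
        using connected_subset_inside[OF J] connected_arc_set_minus_ends[OF arc] by blast
      moreover have "\<phi> b \<in> P e - {\<phi> a}"
        using arc_set_ends[OF arc] by auto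
      ultimately show ?thesis
        using out(2) by blast
    qed
  qed
  show ?thesis
  proof (rule equals0I)
    fix z assume z: "z \<in> inside (boundary t) \<inter> D"
    then consider v where "v \<in> V" "z = \<phi> v" | e where "e \<in> E" "z \<in> P e"
      by (auto simp: drawing_def)
    then show False
    proof cases
      case 1
      then show ?thesis
        using z vertex_notin_inside[OF J boundary_subset_D] by blast
    next
      case 2
      then show ?thesis
        using z edge by blast
    qed
  qed
qed

lemma inside_triangle_face:
  assumes "triangle t"
  shows "inside (boundary t) \<in> weak_dual_verts V E \<phi> \<gamma>"
  using inside_in_components[OF jordan_boundary[OF assms] boundary_subset_D inside_triangle_Int_D[OF assms]]
    jordan_setD(4)[OF jordan_boundary[OF assms]]
  by (simp add: weak_dual_verts_def faces_def)

lemma inside_triangles_disjoint: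
  assumes "triangle t" "triangle t'" "t \<noteq> t'"
  shows "inside (boundary t) \<inter> inside (boundary t') = {}"
proof -
  have "boundary t \<noteq> boundary t'"
    using assms boundary_inject by blast
  then show ?thesis
    by (intro inside_disjoint[where D = D] jordan_boundary boundary_subset_D
        inside_triangle_Int_D assms(1,2))
qed

text \<open>The insides miss each other and everything drawn, so only the two curves can
  overlap.\<close>

lemma filling_Int:
  assumes "triangle t" "triangle t'" "t \<noteq> t'"
  shows "filling (boundary t) \<inter> filling (boundary t') = boundary t \<inter> boundary t'"
  using inside_triangles_disjoint[OF assms] inside_triangle_Int_D assms boundary_subset_D
  unfolding filling_def by blast

lemma boundary_Int:
  "boundary t \<inter> boundary t' \<subseteq> (\<Union>e\<in>{e \<in> E. e \<subseteq> t \<inter> t'}. P e) \<union> \<phi> ` (t \<inter> t')"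
proof
  fix z assume "z \<in> boundary t \<inter> boundary t'"
  then obtain e e' where e: "e \<in> E" "e \<subseteq> t" "z \<in> P e" "e' \<in> E" "e' \<subseteq> t'" "z \<in> P e'"
    by (auto simp: boundary_def)
  show "z \<in> (\<Union>e\<in>{e \<in> E. e \<subseteq> t \<inter> t'}. P e) \<union> \<phi> ` (t \<inter> t')"
  proof (cases "e = e'")
    case False
    then have "z \<in> \<phi> ` (e \<inter> e')"
      using P_Int e by blast
    then show ?thesis
      using e by blast
  qed (use e in auto)
qed

lemma boundary_Int_edge:
  assumes "triangle t" "triangle t'" "t \<inter> t' = {a, b}" "a \<noteq> b"
  shows "boundary t \<inter> boundary t' = P {a, b}"
proof
  have "a \<in> t" "b \<in> t"
    using assms(3) by auto
  then have ab: "{a, b} \<in> E"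
    using assms(1,4) by (auto simp: triangle_def clique_def)
  then show "P {a, b} \<subseteq> boundary t \<inter> boundary t'"
    using assms(3) unfolding boundary_def by blast
  have "\<phi> ` {a, b} \<subseteq> P {a, b}"
    using P_Int_V[OF ab] by blast
  moreover have "{e \<in> E. e \<subseteq> t \<inter> t'} = {{a, b}}"
    using assms(3) ab edge_eq_doubleton by auto
  ultimately show "boundary t \<inter> boundary t' \<subseteq> P {a, b}"
    using boundary_Int[of t t'] assms(3) by auto
qed

section \<open>Configurations excluded by outerplanarity\<close>

text \<open>The three filled triangles at \<open>p\<close> are glued: two along
  \<open>{p, q}\<close>, the third along \<open>{p, r}\<close> and \<open>{p, s}\<close>, which meet
  at \<open>p\<close>. The union does not separate the plane and contains the curve of
  \<open>{q, r, s}\<close>, so it would have to meet the inside of that triangle, which is a face of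
  its own.\<close>

lemma no_K4:
  assumes E: "{p, q} \<in> E" "{p, r} \<in> E" "{p, s} \<in> E" "{q, r} \<in> E" "{q, s} \<in> E" "{r, s} \<in> E"
  shows False
proof -
  have ne: "p \<noteq> q" "p \<noteq> r" "p \<noteq> s" "q \<noteq> r" "q \<noteq> s" "r \<noteq> s"
    using E simple_graph_edgeD(3)[OF sg] by blast+
  note T = triangleI[OF E(1,2,4)] triangleI[OF E(1,3,5)] triangleI[OF E(2,3,6)] triangleI[OF E(4,5,6)]
  note B = boundary_eq[OF E(1,2,4)] boundary_eq[OF E(1,3,5)] boundary_eq[OF E(2,3,6)] boundary_eq[OF E(4,5,6)]
  have neT: "{p, q, r} \<noteq> {p, q, s}" "{p, q, r} \<noteq> {p, r, s}" "{p, q, s} \<noteq> {p, r, s}"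
    "{q, r, s} \<noteq> {p, q, r}" "{q, r, s} \<noteq> {p, q, s}" "{q, r, s} \<noteq> {p, r, s}"
    using ne by auto
  let ?F = "\<lambda>t. filling (boundary t)"
  note N = nonseparating_filling[OF jordan_boundary]
  have conn: "connected (P {p, r})" "connected (P {p, s})" "connected (P {p, q})"
    using arc_set_connected arc_set_edge E by blast+
  have "?F {p, q, r} \<inter> ?F {p, q, s} = P {p, q}"
    using filling_Int[OF T(1,2) neT(1)] boundary_Int_edge[OF T(1,2), of p q] ne by auto
  then have 1: "nonseparating (?F {p, q, r} \<union> ?F {p, q, s})"
    using conn by (intro nonseparating_Un N T) simp
  have "?F {p, q, r} \<inter> ?F {p, r, s} = P {p, r}" "?F {p, q, s} \<inter> ?F {p, r, s} = P {p, s}"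
    using filling_Int[OF T(1,3) neT(2)] boundary_Int_edge[OF T(1,3), of p r]
      filling_Int[OF T(2,3) neT(3)] boundary_Int_edge[OF T(2,3), of p s] ne by auto
  then have "(?F {p, q, r} \<union> ?F {p, q, s}) \<inter> ?F {p, r, s} = P {p, r} \<union> P {p, s}"
    by blast
  moreover have "\<phi> p \<in> P {p, r} \<inter> P {p, s}"
    using P_Int_V[OF E(2)] P_Int_V[OF E(3)] by blast
  ultimately have "connected ((?F {p, q, r} \<union> ?F {p, q, s}) \<inter> ?F {p, r, s})"
    using conn connected_Un[of "P {p, r}" "P {p, s}"] by auto
  then have "nonseparating (?F {p, q, r} \<union> ?F {p, q, s} \<union> ?F {p, r, s})"
    by (rule nonseparating_Un[OF 1 N[OF T(3)]])
  then have "inside (boundary {q, r, s}) \<inter> (?F {p, q, r} \<union> ?F {p, q, s} \<union> ?F {p, r, s}) \<noteq> {}"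
    by (rule nonseparating_meets_inside[OF _ jordan_boundary[OF T(4)]])
      (auto simp: filling_def B)
  moreover have "inside (boundary {q, r, s}) \<inter> ?F t = {}" if "triangle t" "{q, r, s} \<noteq> t" for t
    using inside_triangles_disjoint[OF T(4) that] inside_triangle_Int_D[OF T(4)] boundary_subset_D
    unfolding filling_def by blast
  ultimately show False
    using T neT by blast
qed

text \<open>The paths from \<open>x\<close> to \<open>y\<close> through \<open>a\<close>,
  \<open>b\<close> and \<open>c\<close> form a theta curve. By \<open>theta_arc_inside\<close> one
  of them enters the region bounded by the other two, and it brings its middle vertex along.\<close>

lemma no_three_triangles_on_edge:
  assumes "{x, y} \<in> E" and a: "{x, a} \<in> E" "{a, y} \<in> E" and b: "{x, b} \<in> E" "{b, y} \<in> E"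
    and c: "{x, c} \<in> E" "{c, y} \<in> E" and ne: "a \<noteq> b" "a \<noteq> c" "b \<noteq> c"
  shows False
proof -
  define L where "L = (\<lambda>v. P {x, v} \<union> P {v, y})"
  have "x \<noteq> y"
    using assms(1) simple_graph_edgeD(3)[OF sg] by blast
  have arc: "arc_set (L v) (\<phi> x) (\<phi> y)" if "{x, v} \<in> E" "{v, y} \<in> E" for v
    unfolding L_def using that \<open>x \<noteq> y\<close> by (rule arc_set_two_edges)
  have Int: "L u \<inter> L v \<subseteq> {\<phi> x, \<phi> y}"
    if uv: "{x, u} \<in> E" "{u, y} \<in> E" "{x, v} \<in> E" "{v, y} \<in> E" "u \<noteq> v" for u v
  proof -
    have n: "u \<noteq> x" "u \<noteq> y" "v \<noteq> x" "v \<noteq> y"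
      using uv simple_graph_edgeD(3)[OF sg] by blast+
    have "P {x, u} \<inter> P {x, v} = \<phi> ` ({x, u} \<inter> {x, v})" "P {x, u} \<inter> P {v, y} = \<phi> ` ({x, u} \<inter> {v, y})"
      "P {u, y} \<inter> P {x, v} = \<phi> ` ({u, y} \<inter> {x, v})" "P {u, y} \<inter> P {v, y} = \<phi> ` ({u, y} \<inter> {v, y})"
      by (rule P_Int; use uv n \<open>x \<noteq> y\<close> in \<open>auto simp: doubleton_eq_iff\<close>)+
    then show ?thesis
      unfolding L_def using n uv(5) \<open>x \<noteq> y\<close> by auto
  qed
  have out: "L w \<inter> inside (L u \<union> L v) = {}"
    if w: "{x, w} \<in> E" "{w, y} \<in> E" and uv: "{x, u} \<in> E" "{u, y} \<in> E" "{x, v} \<in> E" "{v, y} \<in> E"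
      and d: "u \<noteq> v" "u \<noteq> w" "v \<noteq> w" for u v w
  proof (rule ccontr)
    assume meets: "L w \<inter> inside (L u \<union> L v) \<noteq> {}"
    have J: "jordan_set (L u \<union> L v)"
      using jordan_set_join arc Int uv d(1) by blast
    have "L w \<inter> (L u \<union> L v) \<subseteq> {\<phi> x, \<phi> y}"
      using Int[OF w uv(1,2)] Int[OF w uv(3,4)] d by blast
    moreover have "{\<phi> x, \<phi> y} \<subseteq> L u \<union> L v"
      using arc_set_ends[OF arc[OF uv(1,2)]] by blast
    ultimately have "(L w - {\<phi> x, \<phi> y}) \<inter> (L u \<union> L v) = {}"
      "(L w - {\<phi> x, \<phi> y}) \<inter> inside (L u \<union> L v) \<noteq> {}"
      using meets inside_no_overlap[of "L u \<union> L v"] by blast+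
    then have "L w - {\<phi> x, \<phi> y} \<subseteq> inside (L u \<union> L v)"
      using connected_subset_inside[OF J] connected_arc_set_minus_ends(3)[OF arc[OF w]] by blast
    moreover have wV: "w \<in> V" "x \<in> V" "y \<in> V" "w \<noteq> x" "w \<noteq> y"
      using w simple_graph_edgeD[OF sg] by blast+
    then have "\<phi> w \<noteq> \<phi> x" "\<phi> w \<noteq> \<phi> y"
      using inj_phi by (auto dest: inj_onD)
    moreover have "\<phi> w \<in> L w"
      unfolding L_def using P_Int_V[OF w(1)] by blast
    ultimately have "\<phi> w \<in> inside (L u \<union> L v)"
      by blast
    moreover have "L u \<union> L v \<subseteq> D"
      unfolding L_def using P_subset_D uv by auto
    ultimately show False
      using vertex_notin_inside[OF J] wV by blast
  qed
  have "L a \<inter> inside (L b \<union> L c) = {}" "L b \<inter> inside (L a \<union> L c) = {}" "L c \<inter> inside (L a \<union> L b) = {}"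
    using out a b c ne by metis+
  then show False
    using theta_arc_inside[of "L a" "\<phi> x" "\<phi> y" "L b" "L c"] arc Int a b c ne by blast
qed

section \<open>The drawing with all triangles filled in\<close>

text \<open>Once \<open>patch V\<close> is known not to separate the plane, its complement is a
  single unbounded region. General \<open>U\<close> serves the induction over vertices.\<close>

definition patch :: "'a set \<Rightarrow> complex set" where
  "patch U = \<phi> ` U \<union> boundary U \<union> (\<Union>t\<in>{t. triangle t \<and> t \<subseteq> U}. inside (boundary t))"

lemma D_eq: "D = \<phi> ` V \<union> boundary V"
  using edge_subset by (auto simp: drawing_def boundary_def)

lemma vertex_notin_patch:
  assumes "U \<subseteq> V" "v \<in> V" "v \<notin> U"
  shows "\<phi> v \<notin> patch U"
proof
  assume "\<phi> v \<in> patch U"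
  then consider "\<phi> v \<in> \<phi> ` U" | e where "e \<in> E" "e \<subseteq> U" "\<phi> v \<in> P e"
    | t where "triangle t" "\<phi> v \<in> inside (boundary t)"
    by (auto simp: patch_def boundary_def)
  then show False
  proof cases
    case 1
    then show ?thesis
      using inj_phi assms by (auto dest: inj_onD)
  next
    case 2
    then have "\<phi> v \<in> \<phi> ` e"
      using P_Int_V assms(2) by blast
    then show ?thesis
      using inj_phi assms 2 by (auto dest!: inj_onD)
  next
    case 3
    then show ?thesis
      using vertex_notin_inside[OF jordan_boundary boundary_subset_D] assms(2) by blast
  qed
qed

text \<open>The edge is drawn and so misses the insides of triangles; the rest of the patch consists
  of other vertices and edges, which it can meet only in its own ends, and \<open>v\<close> is not
  in the patch.\<close>

lemma edge_Int_patch: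
  assumes "U \<subseteq> V" "v \<in> V" "v \<notin> U" "{v, u} \<in> E"
  shows "P {v, u} \<inter> patch U \<subseteq> {\<phi> u}"
proof
  fix z assume z: "z \<in> P {v, u} \<inter> patch U"
  then have "z \<noteq> \<phi> v"
    using vertex_notin_patch assms by blast
  have "z \<in> D"
    using z P_subset_D[OF assms(4)] by blast
  then have "z \<in> \<phi> ` U \<or> z \<in> boundary U"
    using z inside_triangle_Int_D unfolding patch_def by blast
  then have "z \<in> \<phi> ` {v, u}"
  proof
    assume "z \<in> \<phi> ` U"
    then show ?thesis
      using z P_Int_V[OF assms(4)] assms(1) by blast
  next
    assume "z \<in> boundary U"
    then obtain e where e: "e \<in> E" "e \<subseteq> U" "z \<in> P e"
      by (auto simp: boundary_def)
    then have "e \<noteq> {v, u}"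
      using assms(3) by blast
    then show ?thesis
      using P_Int[OF e(1) assms(4)] e(3) z by blast
  qed
  then show "z \<in> {\<phi> u}"
    using \<open>z \<noteq> \<phi> v\<close> by blast
qed

text \<open>Bounds what \<open>v\<close> adds to the patch; every triangle of \<open>U\<close>
  through \<open>v\<close> consists of \<open>v\<close> and neighbours of \<open>v\<close>.\<close>

lemma patch_insert_subset:
  assumes "U \<subseteq> V" "v \<in> U"
  shows "patch U \<subseteq> patch (U - {v}) \<union> {\<phi> v} \<union> (\<Union>u\<in>{u \<in> U. {v, u} \<in> E}. P {v, u}) \<union>
    (\<Union>t\<in>{t. triangle t \<and> t \<subseteq> insert v {u \<in> U. {v, u} \<in> E}}. inside (boundary t))"
proof
  fix z assume "z \<in> patch U"
  then consider "z \<in> \<phi> ` U" | e where "e \<in> E" "e \<subseteq> U" "z \<in> P e"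
    | t where "triangle t" "t \<subseteq> U" "z \<in> inside (boundary t)"
    by (auto simp: patch_def boundary_def)
  then show "z \<in> patch (U - {v}) \<union> {\<phi> v} \<union> (\<Union>u\<in>{u \<in> U. {v, u} \<in> E}. P {v, u}) \<union>
    (\<Union>t\<in>{t. triangle t \<and> t \<subseteq> insert v {u \<in> U. {v, u} \<in> E}}. inside (boundary t))"
  proof cases
    case 1
    then show ?thesis
      by (auto simp: patch_def)
  next
    case 2
    show ?thesis
    proof (cases "v \<in> e")
      case True
      moreover have "card e = 2"
        using 2 sg by (simp add: simple_graph_def)
      ultimately obtain u where "e = {v, u}"
        by (auto simp: card_2_iff)
      then show ?thesis
        using 2 by auto
    next
      case False
      then have "z \<in> boundary (U - {v})"
        using 2 unfolding boundary_def by blast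
      then show ?thesis
        by (simp add: patch_def)
    qed
  next
    case 3
    show ?thesis
    proof (cases "v \<in> t")
      case True
      then have "t \<subseteq> insert v {u \<in> U. {v, u} \<in> E}"
        using 3 by (auto simp: triangle_def clique_def)
      then show ?thesis
        using 3 by blast
    next
      case False
      then have "t \<subseteq> U - {v}"
        using 3 by blast
      then show ?thesis
        using 3 unfolding patch_def by blast
    qed
  qed
qed

lemma patch_mono: "U' \<subseteq> U \<Longrightarrow> patch U' \<subseteq> patch U"
  unfolding patch_def boundary_def by blast

lemma card_triangle: "triangle t \<Longrightarrow> card t = 3"
  by (simp add: triangle_def)

text \<open>Induction by removing a simplicial vertex \<open>v\<close>. Its neighbours in
  \<open>U\<close> form a clique, so by \<open>no_K4\<close> there are at most two, and the new
  piece meets the old patch in nothing, in a point, or in the edge \<open>{a, b}\<close>; each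
  overlap is connected.\<close>

lemma nonseparating_patch:
  assumes ch: "chordal E" and "U \<subseteq> V"
  shows "nonseparating (patch U)"
  using assms(2)
proof (induction "card U" arbitrary: U rule: less_induct)
  case less
  have finU: "finite U"
    using less.prems fin finite_subset by blast
  show ?case
  proof (cases "U = {}")
    case True
    have "patch U = {}"
      using True sg by (auto simp: patch_def boundary_def simple_graph_def triangle_def)
    then show ?thesis
      by (simp add: nonseparating_def convex_connected)
  next
    case False
    then obtain v where v: "simplicial_in E U v"
      using chordal_simplicial_exists[OF sg ch finU] by blast
    then have vU: "v \<in> U" "v \<in> V"
      using less.prems by (auto simp: simplicial_in_def)
    define N where "N = {u \<in> U. {v, u} \<in> E}"
    have NE: "{v, u} \<in> E" "u \<in> U - {v}" if "u \<in> N" for u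
      using that simple_graph_edgeD(3)[OF sg, of v u] by (auto simp: N_def)
    have cl: "{a, b} \<in> E" if "a \<in> N" "b \<in> N" "a \<noteq> b" for a b
      using v that by (auto simp: simplicial_in_def N_def)
    let ?H = "patch (U - {v})"
    have IH: "nonseparating ?H"
      using less.prems card_Diff1_less[OF finU vU(1)] by (intro less.hyps) auto
    have U': "U - {v} \<subseteq> V" "v \<notin> U - {v}"
      using less.prems by auto
    note sub = patch_insert_subset[OF less.prems vU(1), folded N_def]
    have sup: "?H \<subseteq> patch U" "\<phi> v \<in> patch U"
      using patch_mono[of "U - {v}" U] vU by (auto simp: patch_def)
    have supP: "P {v, u} \<subseteq> patch U" if "u \<in> N" for u
      using NE[OF that] vU by (auto simp: patch_def boundary_def)
    have Hu: "\<phi> u \<in> ?H" if "u \<in> N" for u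
      using NE[OF that] by (auto simp: patch_def)
    have vP: "\<phi> v \<in> P {v, u}" "\<phi> u \<in> P {v, u}" if "u \<in> N" for u
      using P_Int_V[OF NE(1)[OF that]] by auto
    have no_tri: "{t. triangle t \<and> t \<subseteq> insert v N} = {}" if "card (insert v N) < 3"
    proof (rule equals0I)
      fix t assume t: "t \<in> {t. triangle t \<and> t \<subseteq> insert v N}"
      have "finite (insert v N)"
        using finU by (simp add: N_def)
      then have "card t \<le> card (insert v N)"
        using t by (intro card_mono) auto
      moreover have "card t = 3"
        using t card_triangle by blast
      ultimately show False
        using that by simp
    qed
    consider "N = {}" | a where "N = {a}" | a b where "N = {a, b}" "a \<noteq> b"
      | a b c where "a \<in> N" "b \<in> N" "c \<in> N" "a \<noteq> b" "a \<noteq> c" "b \<noteq> c"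
    proof -
      assume h: "N = {} \<Longrightarrow> thesis" "\<And>a. N = {a} \<Longrightarrow> thesis" "\<And>a b. N = {a, b} \<Longrightarrow> a \<noteq> b \<Longrightarrow> thesis"
        "\<And>a b c. a \<in> N \<Longrightarrow> b \<in> N \<Longrightarrow> c \<in> N \<Longrightarrow> a \<noteq> b \<Longrightarrow> a \<noteq> c \<Longrightarrow> b \<noteq> c \<Longrightarrow> thesis"
      show thesis
      proof (cases "\<exists>a b. a \<in> N \<and> b \<in> N \<and> a \<noteq> b")
        case True
        then obtain a b where ab: "a \<in> N" "b \<in> N" "a \<noteq> b"
          by blast
        show thesis
        proof (cases "N \<subseteq> {a, b}")
          case True
          then have "N = {a, b}"
            using ab by blast
          then show thesis
            using h(3) ab by blast
        next
          case False
          then obtain c where "c \<in> N" "c \<noteq> a" "c \<noteq> b"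
            by blast
          then show thesis
            using h(4)[of a b c] ab by simp
        qed
      next
        case False
        then show thesis
          using h(1) h(2) by (metis is_singletonI' is_singleton_the_elem)
      qed
    qed
    then show ?thesis
    proof cases
      case 1
      have "card (insert v N) < 3"
        by (simp add: 1)
      then have "patch U \<subseteq> ?H \<union> {\<phi> v}"
        using sub by (simp only: no_tri) (simp add: 1)
      then have "patch U = ?H \<union> {\<phi> v}"
        using sup by blast
      moreover have "?H \<inter> {\<phi> v} = {}"
        using vertex_notin_patch[OF U'(1) vU(2) U'(2)] by blast
      ultimately show ?thesis
        using nonseparating_Un[OF IH nonseparating_singleton[of "\<phi> v"]] by simp
    next
      case 2
      have "card (insert v N) < 3"
        by (simp add: 2 card_insert_if)
      then have "patch U \<subseteq> ?H \<union> P {v, a}"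
        using sub vP[of a] by (simp only: no_tri) (auto simp: 2)
      then have "patch U = ?H \<union> P {v, a}"
        using sup supP[of a] by (auto simp: 2)
      moreover have "?H \<inter> P {v, a} = {\<phi> a}"
        using edge_Int_patch[OF U'(1) vU(2) U'(2) NE(1)] vP[of a] Hu[of a] by (auto simp: 2)
      ultimately show ?thesis
        using nonseparating_Un[OF IH nonseparating_arc_set[OF arc_set_edge[OF NE(1)[of a]]]]
        by (simp add: 2)
    next
      case 3
      have aN: "a \<in> N" and bN: "b \<in> N"
        using 3 by auto
      note va = NE(1)[OF aN] and vb = NE(1)[OF bN] and ab = cl[OF aN bN 3(2)]
      let ?t = "{v, a, b}"
      have T: "triangle ?t"
        using triangleI[OF va vb ab] .
      note B = boundary_eq[OF va vb ab]
      have Pab: "P {a, b} \<subseteq> ?H"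
        using NE[OF aN] NE[OF bN] ab by (auto simp: patch_def boundary_def)
      \<comment> \<open>Here \<open>insert v N\<close> has exactly three elements, so only one new
        triangle gets filled.\<close>
      have tri: "t = ?t" if "triangle t" "t \<subseteq> insert v N" for t
        using that card_triangle[OF T] card_triangle[of t] 3(1)
        by (intro card_subset_eq) auto
      have "patch U = ?H \<union> filling (boundary ?t)"
      proof
        show "patch U \<subseteq> ?H \<union> filling (boundary ?t)"
        proof
          fix z assume "z \<in> patch U"
          then consider "z \<in> ?H" | "z = \<phi> v" | u where "u \<in> N" "z \<in> P {v, u}"
            | t where "triangle t" "t \<subseteq> insert v N" "z \<in> inside (boundary t)"
            using sub by blast
          then show "z \<in> ?H \<union> filling (boundary ?t)"
          proof cases
            case 2
            then show ?thesis
              using vP[OF aN] by (simp add: filling_def B)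
          next
            case (3 u)
            then show ?thesis
              using \<open>N = {a, b}\<close> by (auto simp: filling_def B)
          next
            case (4 t)
            then show ?thesis
              using tri by (auto simp: filling_def)
          qed simp
        qed
        have "inside (boundary ?t) \<subseteq> patch U"
          using T NE[OF aN] NE[OF bN] vU unfolding patch_def by blast
        then show "?H \<union> filling (boundary ?t) \<subseteq> patch U"
          using sup supP[OF aN] supP[OF bN] Pab by (auto simp: filling_def B)
      qed
      moreover have "?H \<inter> filling (boundary ?t) = P {a, b}"
      proof
        \<comment> \<open>A point of the overlap is not drawn, so it lies inside a triangle avoiding
          \<open>v\<close>; that triangle differs from \<open>?t\<close>, and the two insides are
          disjoint.\<close>
        have "inside (boundary ?t) \<inter> ?H = {}"
        proof (rule equals0I)
          fix z assume z: "z \<in> inside (boundary ?t) \<inter> ?H"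
          then have "z \<notin> \<phi> ` (U - {v}) \<union> boundary (U - {v})"
            using inside_triangle_Int_D[OF T] U'(1) boundary_subset_D[of "U - {v}"] D_eq by blast
          then obtain t where t: "triangle t" "t \<subseteq> U - {v}" "z \<in> inside (boundary t)"
            using z unfolding patch_def by blast
          then have "t \<noteq> ?t"
            by blast
          then show False
            using inside_triangles_disjoint[OF t(1) T] t z by blast
        qed
        moreover have "P {v, a} \<inter> ?H \<subseteq> P {a, b}" "P {v, b} \<inter> ?H \<subseteq> P {a, b}"
          using edge_Int_patch[OF U'(1) vU(2) U'(2) va] edge_Int_patch[OF U'(1) vU(2) U'(2) vb]
            P_Int_V[OF ab] by blast+
        ultimately show "?H \<inter> filling (boundary ?t) \<subseteq> P {a, b}"
          unfolding filling_def B by blast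
        show "P {a, b} \<subseteq> ?H \<inter> filling (boundary ?t)"
          using Pab by (auto simp: filling_def B)
      qed
      ultimately show ?thesis
        using nonseparating_Un[OF IH nonseparating_filling[OF jordan_boundary[OF T]]]
          arc_set_connected[OF arc_set_edge[OF ab]] by simp
    next
      case 4
      then show ?thesis
        using no_K4[of v a b c] NE(1) cl by blast
    qed
  qed
qed

section \<open>Bounded faces and the weak dual\<close>

text \<open>A face missing the insides of all triangles lies in the complement of
  \<open>patch V\<close>. This complement is connected and avoids the drawing, so the face contains
  it and is unbounded.\<close>

lemma bounded_face_triangle:
  assumes "chordal E" "F \<in> weak_dual_verts V E \<phi> \<gamma>"
  obtains t where "triangle t" "F = inside (boundary t)"
proof -
  have F: "F \<in> components (- D)" "bounded F"
    using assms(2) by (auto simp: weak_dual_verts_def faces_def)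
  have "\<exists>t. triangle t \<and> F \<inter> inside (boundary t) \<noteq> {}"
  proof (rule ccontr)
    assume none: "\<not> ?thesis"
    have "F \<subseteq> - D" "F \<noteq> {}"
      using in_components_subset[OF F(1)] in_components_nonempty[OF F(1)] by auto
    then have "F \<subseteq> - patch V"
      using none unfolding patch_def D_eq by blast
    moreover have "- patch V \<subseteq> - D"
      by (auto simp: patch_def D_eq)
    moreover have N: "nonseparating (patch V)"
      by (rule nonseparating_patch[OF assms(1)]) simp
    ultimately have "- patch V \<subseteq> F"
      using components_maximal[OF F(1), of "- patch V"] \<open>F \<noteq> {}\<close> by (auto simp: nonseparating_def)
    then show False
      using F(2) nonseparating_Compl_unbounded[OF N] bounded_subset by blast
  qed
  then obtain t where t: "triangle t" "F \<inter> inside (boundary t) \<noteq> {}"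
    by blast
  have "inside (boundary t) \<in> components (- D)"
    using inside_triangle_face[OF t(1)] by (simp add: weak_dual_verts_def faces_def)
  then have "F = inside (boundary t)"
    using components_eq[OF F(1)] t(2) by blast
  then show ?thesis
    using t(1) that by blast
qed

lemma inside_boundary_inject:
  assumes "triangle t" "triangle t'" "inside (boundary t) = inside (boundary t')"
  shows "t = t'"
  using assms boundary_inject jordan_setD(6)[OF jordan_boundary] by metis

lemma edge_subset_triangle:
  assumes "triangle t" "e \<in> E" "P e \<subseteq> boundary t"
  shows "e \<subseteq> t"
proof -
  have "\<phi> ` e \<subseteq> \<phi> ` t"
    using P_Int_V[OF assms(2)] boundary_Int_V[OF assms(1)] assms(3) by blast
  then show ?thesis
    using inj_on_image_subset_iff[OF inj_phi] edge_subset[OF assms(2)] assms(1)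
    by (auto simp: triangle_def)
qed

lemma triangle_on_edgeE:
  assumes "triangle t" "{p, q} \<in> E" "{p, q} \<subseteq> t"
  obtains r where "t = {p, q, r}" "{p, r} \<in> E" "{q, r} \<in> E" "r \<noteq> p" "r \<noteq> q"
proof -
  have "p \<noteq> q"
    using simple_graph_edgeD(3)[OF sg assms(2)] .
  obtain u v w where "t = {u, v, w}" "u \<noteq> v" "u \<noteq> w" "v \<noteq> w"
    "{u, v} \<in> E" "{u, w} \<in> E" "{v, w} \<in> E"
    using triangleE[OF assms(1)] .
  then have "\<exists>r. t = {p, q, r} \<and> {p, r} \<in> E \<and> {q, r} \<in> E \<and> r \<noteq> p \<and> r \<noteq> q"
    using assms(3) \<open>p \<noteq> q\<close> by (auto simp: insert_commute)
  then show ?thesis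
    using that by blast
qed

text \<open>Dual edges at \<open>F\<close> correspond to triangles sharing an edge with
  \<open>t\<close>. There are two of these, on different edges of \<open>t\<close>; \<open>x\<close>
  is the vertex common to these edges, and the third edge of \<open>t\<close> carries no other
  triangle.\<close>

lemma weak_dual_degree_two:
  assumes ch: "chordal E" and F: "F \<in> weak_dual_verts V E \<phi> \<gamma>"
    and deg: "vdegree (weak_dual_edges V E \<phi> \<gamma>) F = 2"
  obtains x y z a b where "{x, y} \<in> E" "{x, z} \<in> E" "{y, z} \<in> E"
    "{x, a} \<in> E" "{y, a} \<in> E" "a \<noteq> z" "{x, b} \<in> E" "{z, b} \<in> E" "b \<noteq> y"
    "\<forall>c. {y, c} \<in> E \<and> {c, z} \<in> E \<longrightarrow> c = x"
proof -
  obtain t where t: "triangle t" "F = inside (boundary t)"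
    using bounded_face_triangle[OF ch F] .
  have frontier: "frontier (inside (boundary s)) = boundary s" if "triangle s" for s
    using jordan_setD(6)[OF jordan_boundary[OF that]] .
  define adj where "adj = (\<lambda>s. triangle s \<and> s \<noteq> t \<and> (\<exists>e\<in>E. e \<subseteq> t \<and> e \<subseteq> s))"
  let ?W = "{e \<in> weak_dual_edges V E \<phi> \<gamma>. F \<in> e}"
  have nbr: "\<exists>s. adj s \<and> f = {F, inside (boundary s)}" if f: "f \<in> ?W" for f
  proof -
    obtain G where G: "G \<in> weak_dual_verts V E \<phi> \<gamma>" "G \<noteq> F" "f = {F, G}"
      "\<exists>e\<in>E. P e \<subseteq> frontier F \<and> P e \<subseteq> frontier G"
      using f unfolding weak_dual_edges_def by auto
    obtain s where s: "triangle s" "G = inside (boundary s)"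
      using bounded_face_triangle[OF ch G(1)] .
    obtain e where e: "e \<in> E" "P e \<subseteq> boundary t" "P e \<subseteq> boundary s"
      using G(4) frontier t s by auto
    have "e \<subseteq> t" "e \<subseteq> s"
      using edge_subset_triangle[OF t(1) e(1,2)] edge_subset_triangle[OF s(1) e(1,3)] .
    moreover have "s \<noteq> t"
      using G(2) s t by auto
    ultimately have "adj s"
      unfolding adj_def using s(1) e(1) by blast
    then show ?thesis
      using G(3) s(2) by blast
  qed
  have nbr': "{F, inside (boundary s)} \<in> ?W" if s: "adj s" for s
  proof -
    obtain e where e: "e \<in> E" "e \<subseteq> t" "e \<subseteq> s"
      using s by (auto simp: adj_def)
    then have "P e \<subseteq> boundary t" "P e \<subseteq> boundary s"
      by (auto simp: boundary_def)
    moreover have "triangle s" "inside (boundary s) \<noteq> F"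
      using s t inside_boundary_inject by (auto simp: adj_def)
    moreover from this have "inside (boundary s) \<in> weak_dual_verts V E \<phi> \<gamma>"
      using inside_triangle_face by blast
    ultimately have "{F, inside (boundary s)} \<in> weak_dual_edges V E \<phi> \<gamma>"
      unfolding weak_dual_edges_def using F e(1) frontier t
      by (intro CollectI exI[of _ F] exI[of _ "inside (boundary s)"]) auto
    then show ?thesis
      by simp
  qed
  have "card ?W = 2"
    using deg by (simp add: vdegree_def)
  then obtain f1 f2 where f: "?W = {f1, f2}" "f1 \<noteq> f2"
    by (auto simp: card_2_iff)
  obtain t1 where t1: "adj t1" "f1 = {F, inside (boundary t1)}"
    using nbr[of f1] f by blast
  obtain t2 where t2: "adj t2" "f2 = {F, inside (boundary t2)}"
    using nbr[of f2] f by blast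
  have "t1 \<noteq> t2"
    using f(2) t1(2) t2(2) by auto
  have all: "s = t1 \<or> s = t2" if "adj s" for s
  proof -
    have "{F, inside (boundary s)} \<in> {f1, f2}"
      using nbr'[OF that] by (simp only: f(1))
    then have "inside (boundary s) = inside (boundary t1) \<or> inside (boundary s) = inside (boundary t2)"
      using t1 t2 by (auto simp: doubleton_eq_iff)
    then show ?thesis
      using inside_boundary_inject that t1 t2 by (auto simp: adj_def)
  qed
  obtain e1 where e1: "e1 \<in> E" "e1 \<subseteq> t" "e1 \<subseteq> t1"
    using t1 by (auto simp: adj_def)
  obtain e2 where e2: "e2 \<in> E" "e2 \<subseteq> t" "e2 \<subseteq> t2"
    using t2 by (auto simp: adj_def)
  have T: "triangle t1" "triangle t2" "t1 \<noteq> t" "t2 \<noteq> t"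
    using t1 t2 by (auto simp: adj_def)
  obtain p q where pq: "e1 = {p, q}" "p \<noteq> q"
    using sg e1 unfolding simple_graph_def by (metis card_2_iff)
  have pqE: "{p, q} \<in> E" "{p, q} \<subseteq> t" "{p, q} \<subseteq> t1"
    using e1 pq by auto
  obtain r where r: "t = {p, q, r}" "{p, r} \<in> E" "{q, r} \<in> E" "r \<noteq> p" "r \<noteq> q"
    using triangle_on_edgeE[OF t(1) pqE(1,2)] .
  obtain a where a: "t1 = {p, q, a}" "{p, a} \<in> E" "{q, a} \<in> E" "a \<noteq> p" "a \<noteq> q"
    using triangle_on_edgeE[OF T(1) pqE(1,3)] .
  \<comment> \<open>Otherwise \<open>t\<close>, \<open>t1\<close> and \<open>t2\<close> are three
    triangles on the edge \<open>{p, q}\<close>.\<close>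
  have "e1 \<noteq> e2"
  proof
    assume "e1 = e2"
    then have "{p, q} \<subseteq> t2"
      using e2 pq by blast
    then obtain b where b: "t2 = {p, q, b}" "{p, b} \<in> E" "{q, b} \<in> E" "b \<noteq> p" "b \<noteq> q"
      by (rule triangle_on_edgeE[OF T(2) pqE(1)])
    then show False
      using no_three_triangles_on_edge[of p q r a b] r a e1 pq T \<open>t1 \<noteq> t2\<close>
      by (auto simp: insert_commute)
  qed
  \<comment> \<open>As \<open>e2\<close> is an edge of \<open>t\<close> other than
    \<open>{p, q}\<close>, it contains \<open>r\<close> and one of \<open>p\<close>,
    \<open>q\<close>, which becomes \<open>x\<close>. The vertex \<open>r\<close> takes the part of
    \<open>z\<close>.\<close>
  have "\<exists>x y. {p, q} = {x, y} \<and> e2 = {x, r}"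
  proof -
    obtain c d where "e2 = {c, d}" "c \<noteq> d"
      using sg e2 unfolding simple_graph_def by (metis card_2_iff)
    then show ?thesis
      using e2(2) r(1) \<open>e1 \<noteq> e2\<close> pq by (auto simp: doubleton_eq_iff)
  qed
  then obtain x y where xy: "{p, q} = {x, y}" "e2 = {x, r}"
    by blast
  obtain b where b: "t2 = {x, r, b}" "{x, b} \<in> E" "{r, b} \<in> E" "b \<noteq> x" "b \<noteq> r"
    using triangle_on_edgeE[OF T(2), of x r] e2 xy by auto
  have X: "{x, y} \<in> E" "{x, r} \<in> E" "{y, r} \<in> E" "{x, a} \<in> E" "{y, a} \<in> E"
    "t = {x, y, r}" "t1 = {x, y, a}" "x \<noteq> y" "x \<noteq> r" "y \<noteq> r" "a \<noteq> x" "a \<noteq> y"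
    using e1(1) r a pq xy(1) by (auto simp: doubleton_eq_iff insert_commute)
  have "a \<noteq> r"
    using T(3) X by auto
  have "b \<noteq> y"
    using T(4) b X by (auto simp: insert_commute)
  \<comment> \<open>Another common neighbour \<open>c\<close> of \<open>y\<close> and
    \<open>r\<close> would give a triangle sharing an edge with \<open>t\<close> but not containing
    \<open>x\<close>, whereas \<open>t1\<close> and \<open>t2\<close> both contain
    \<open>x\<close>.\<close>
  have only: "c = x" if c: "{y, c} \<in> E" "{c, r} \<in> E" for c
  proof (rule ccontr)
    assume "c \<noteq> x"
    have ne: "c \<noteq> y" "c \<noteq> r"
      using c simple_graph_edgeD(3)[OF sg] by blast+
    have "triangle {y, r, c}"
      using triangleI[of y r c] X c by (simp add: insert_commute)
    moreover have "x \<notin> {y, r, c}"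
      using X \<open>c \<noteq> x\<close> by blast
    then have "{y, r, c} \<noteq> t"
      using X by blast
    ultimately have "adj {y, r, c}"
      unfolding adj_def using X by blast
    then show False
      using all \<open>x \<notin> {y, r, c}\<close> X(7) b(1) by blast
  qed
  show ?thesis
    using that[of x y r a b] X b \<open>a \<noteq> r\<close> \<open>b \<noteq> y\<close> only by blast
qed

end

theorem theorem4p9:
  fixes V :: "'a set" and E :: "'a set set"
    and \<phi> :: "'a \<Rightarrow> complex" and \<gamma> :: "'a set \<Rightarrow> real \<Rightarrow> complex"
  assumes "finite V"
    and "simple_graph V E"
    and "biconnected V E"
    and "chordal E"
    and "outerplane_embedding V E \<phi> \<gamma>"
    and "max_degree V E \<in> {5, 6}"
    and "\<not> full (weak_dual_verts V E \<phi> \<gamma>) (weak_dual_edges V E \<phi> \<gamma>)"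
  shows "clique V (square_edges V E) \<or>
    (\<exists>h \<in> {4, 5, 6, 7}. \<exists>W F. separator V E h W F)"
proof -
  interpret outerplane V E \<phi> \<gamma>
    using assms by unfold_locales
  obtain F where F: "F \<in> weak_dual_verts V E \<phi> \<gamma>" "vdegree (weak_dual_edges V E \<phi> \<gamma>) F = 2"
    using assms(7) by (auto simp: full_def)
  obtain x y z a b where xyz: "{x, y} \<in> E" "{x, z} \<in> E" "{y, z} \<in> E"
    "{x, a} \<in> E" "{y, a} \<in> E" "a \<noteq> z" "{x, b} \<in> E" "{z, b} \<in> E" "b \<noteq> y"
    "\<forall>c. {y, c} \<in> E \<and> {c, z} \<in> E \<longrightarrow> c = x"
    using weak_dual_degree_two[OF assms(4) F] .
  have "x \<in> V"
    using simple_graph_edgeD[OF sg xyz(1)] by simp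
  then have "vdegree E x \<le> max_degree V E"
    unfolding max_degree_def using fin by (intro Max_ge) auto
  then have "vdegree E x \<le> 6"
    using assms(6) by auto
  then show ?thesis
    using separator_at_degree_two_triangle[OF assms(1,2,4) xyz(1-9)] xyz(10) by blast
qed

end
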